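(* Let $N\ge1$ and let $\lambda$ be a partition with $0<\ell(\lambda)<N$. Then the following identity of polynomials in $x_1,\ldots,x_N$ with coefficients in $\mathbb{Z}[t]$ holds: $$\sum_{i=1}^N(-1)^{i+1}x_i^{N-1}\Delta^{(i)}\Bigl(Q_\lambda^{(i)}\bigl(1-t^{\ell(\lambda)}\bigr)+\sum_{\substack{\ell(\mu)=\ell(\lambda)\\ \mu\ne\lambda}}x_i^{n}\,Q_\mu^{(i)}\,\phi_{\lambda\mu}(t)\Bigr)=0,$$ where the inner sum is over partitions $\mu\neq\lambda$ with $\ell(\mu)=\ell(\lambda)$ (only those with $\phi_{\lambda\mu}(t)\neq0$ contribute), and $n$ is determined by $\lambda$ and $\mu$ via $n=(\lambda_1-\mu_1)+(\lambda_2-\mu_2)+\cdots$.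
   Context: $t$ is a formal parameter; $\ell(\lambda)$ is the number of non-zero parts of the partition $\lambda$, $\lambda'$ denotes the conjugate partition, and $k_i$ denotes the multiplicity of the part $i$ in $\lambda$. $\Delta^{(i)}=\Delta(x_1,\ldots,\widehat{x}_i,\ldots,x_N)$ is the Vandermonde product $\prod_{a<b;\ a,b\ne i}(x_a-x_b)$ in the $N-1$ variables other than $x_i$ (equal to $1$ if there is only one such variable), and $Q_\mu^{(i)}=Q_\mu(x_1,\ldots,\widehat{x}_i,\ldots,x_N)$ is the Hall-Littlewood polynomial in the same $N-1$ variables (hats denote omitted variables). Hall-Littlewood polynomials in $M$ variables: for a partition $\mu$ with $\ell(\mu)\le M$, let $m_i$ be the multiplicity of the part $i\ge1$ in $\mu$, let $m_0=M-\ell(\mu)$, and let $v_\mu(t)=\prod_{i\ge0}\prod_{j=1}^{m_i}\frac{1-t^j}{1-t}$, $b_\mu(t)=\prod_{i\ge1}\prod_{j=1}^{m_i}(1-t^j)$. Then $P_\mu(x_1,\ldots,x_M)$ is $v_\mu(t)^{-1}$ times the sum of all $M!$ products obtained from $x_1^{\mu_1}\cdots x_M^{\mu_M}\prod_{1\le i<j\le M}\frac{x_i-t\,x_j}{x_i-x_j}$ by permuting the variables, and $Q_\mu(x_1,\ldots,x_M)=b_\mu(t)P_\mu(x_1,\ldots,x_M)$. The coefficients $\phi_{\lambda\mu}(t)$ are those of the multiplication formula $Q_nP_\mu=\sum_\lambda\phi_{\lambda\mu}(t)P_\lambda$ for Hall-Littlewood symmetric functions, where $Q_n=Q_{(n)}$.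 Explicitly, $\phi_{\lambda\mu}(t)=0$ unless $\lambda_1\ge\mu_1\ge\lambda_2\ge\mu_2\ge\cdots$; when these inequalities hold, $\phi_{\lambda\mu}(t)$ is the product of $1-t^{k_i}$ over all $i\ge1$ such that $\lambda'_i-\mu'_i>\lambda'_{i+1}-\mu'_{i+1}$. *)

theory Defs
  imports
    "HOL-Library.Poly_Mapping"
    "HOL-Computational_Algebra.Computational_Algebra"
    "HOL-Combinatorics.Permutations"
begin

text \<open>
  A partition is the weakly decreasing list of its non-zero parts. Hence \<open>length\<close> is the number
  of non-zero parts and \<open>count_list\<close> is the multiplicity of a part.
\<close>

definition is_partition :: "nat list \<Rightarrow> bool" where
  "is_partition \<mu> \<longleftrightarrow> sorted_wrt (\<ge>) \<mu> \<and> 0 \<notin> set \<mu>"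

text \<open>\<open>part \<mu> j\<close> is the part written $\mu_{j+1}$ in the usual numbering from one.\<close>

definition part :: "nat list \<Rightarrow> nat \<Rightarrow> nat" where
  "part \<mu> j = (if j < length \<mu> then \<mu> ! j else 0)"

text \<open>The argument \<open>i\<close> of \<open>conj_part\<close> is numbered from one: this is $\mu'_i$ for $i \ge 1$.\<close>

definition conj_part :: "nat list \<Rightarrow> nat \<Rightarrow> nat" where
  "conj_part \<mu> i = card {j. j < length \<mu> \<and> i \<le> \<mu> ! j}"

text \<open>
  The Hall-Littlewood polynomials are given by a formula with denominators, so they are defined
  over an arbitrary field, as functions of \<open>t\<close> and of the list \<open>xs\<close> of variables.
  In \<open>hl_v\<close>, the first product belongs to the part 0, of multiplicity \<open>M - length \<mu>\<close>.
\<close>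

definition hl_v :: "'a::field \<Rightarrow> nat \<Rightarrow> nat list \<Rightarrow> 'a" where
  "hl_v t M \<mu> = (\<Prod>j=1..M - length \<mu>. (1 - t ^ j) / (1 - t)) *
     (\<Prod>i\<in>set \<mu>. \<Prod>j=1..count_list \<mu> i. (1 - t ^ j) / (1 - t))"

definition hl_b :: "'a::field \<Rightarrow> nat list \<Rightarrow> 'a" where
  "hl_b t \<mu> = (\<Prod>i\<in>set \<mu>. \<Prod>j=1..count_list \<mu> i. 1 - t ^ j)"

definition hl_P :: "'a::field \<Rightarrow> nat list \<Rightarrow> 'a list \<Rightarrow> 'a" where
  "hl_P t \<mu> xs = inverse (hl_v t (length xs) \<mu>) *
     (\<Sum>\<sigma> | \<sigma> permutes {..<length xs}.
        (\<Prod>i<length xs. (xs ! \<sigma> i) ^ part \<mu> i) *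
        (\<Prod>(i, j) | i < j \<and> j < length xs.
           (xs ! \<sigma> i - t * xs ! \<sigma> j) / (xs ! \<sigma> i - xs ! \<sigma> j)))"

definition hl_Q :: "'a::field \<Rightarrow> nat list \<Rightarrow> 'a list \<Rightarrow> 'a" where
  "hl_Q t \<mu> xs = hl_b t \<mu> * hl_P t \<mu> xs"

definition vandermonde :: "'a::field list \<Rightarrow> 'a" where
  "vandermonde xs = (\<Prod>(a, b) | a < b \<and> b < length xs. xs ! a - xs ! b)"

definition interlaces :: "nat list \<Rightarrow> nat list \<Rightarrow> bool" where
  "interlaces lam \<mu> \<longleftrightarrow> (\<forall>j. part \<mu> j \<le> part lam j \<and> part lam (Suc j) \<le> part \<mu> j)"

definition hl_phi :: "'a::field \<Rightarrow> nat list \<Rightarrow> nat list \<Rightarrow> 'a" where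
  "hl_phi t lam \<mu> = (if interlaces lam \<mu>
     then \<Prod>i | 1 \<le> i \<and> int (conj_part lam i) - int (conj_part \<mu> i)
                       > int (conj_part lam (i + 1)) - int (conj_part \<mu> (i + 1)).
            1 - t ^ count_list lam i
     else 0)"

text \<open>
  The polynomial ring $\mathbb{Z}[t][x_0, x_1, x_2, \ldots]$ and its field of fractions, in which
  the formulas above are evaluated at the indeterminates.
\<close>

type_synonym zt_mpoly = "(nat \<Rightarrow>\<^sub>0 nat) \<Rightarrow>\<^sub>0 int poly"

definition T :: "zt_mpoly fract" where
  "T = Fract (Poly_Mapping.single 0 [:0, 1:]) 1"

definition X :: "nat \<Rightarrow> zt_mpoly fract" where
  "X i = Fract (Poly_Mapping.single (Poly_Mapping.single i 1) 1) 1"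

definition vars_omit :: "nat \<Rightarrow> nat \<Rightarrow> zt_mpoly fract list" where
  "vars_omit N i = map X (remove1 i [1..<Suc N])"

text \<open>
  Infinitely many partitions have a given number of parts, so the inner sum has to be taken
  over those with non-zero coefficient; there are finitely many of them, and the product in
  \<open>hl_phi\<close> is finite as well.
\<close>

definition inner_partitions :: "nat list \<Rightarrow> nat list set" where
  "inner_partitions lam =
     {\<mu>. is_partition \<mu> \<and> length \<mu> = length lam \<and> \<mu> \<noteq> lam \<and> hl_phi T lam \<mu> \<noteq> 0}"

lemma finite_inner_partitions: "finite (inner_partitions lam)"
proof (rule finite_subset)
  show "inner_partitions lam \<subseteq> {\<mu>. set \<mu> \<subseteq> {..Max (set lam)} \<and> length \<mu> = length lam}"
  proof (intro subsetI CollectI conjI)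
    fix \<mu> p assume \<mu>: "\<mu> \<in> inner_partitions lam" and "p \<in> set \<mu>"
    then obtain j where j: "j < length \<mu>" "p = \<mu> ! j"
      by (auto simp: in_set_conv_nth)
    from \<mu> have "interlaces lam \<mu>" and len: "length \<mu> = length lam"
      by (auto simp: inner_partitions_def hl_phi_def split: if_splits)
    then have "part \<mu> j \<le> part lam j" by (auto simp: interlaces_def)
    with j len have "p \<le> lam ! j" "lam ! j \<in> set lam" by (auto simp: part_def)
    then show "p \<in> {..Max (set lam)}" by (simp add: Max_ge order_trans)
  qed (auto simp: inner_partitions_def)
  show "finite {\<mu>. set \<mu> \<subseteq> {..Max (set lam)} \<and> length \<mu> = length lam}"
    by (rule finite_lists_length_eq) simp
qed

lemma finite_hl_phi_index:
  "finite {i. 1 \<le> i \<and> int (conj_part lam i) - int (conj_part \<mu> i)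
                > int (conj_part lam (i + 1)) - int (conj_part \<mu> (i + 1))}" (is "finite ?I")
proof (rule finite_subset)
  have zero: "conj_part \<nu> i = 0" if "sum_list \<nu> < i" for \<nu> i
  proof -
    have "\<nu> ! j < i" if "j < length \<nu>" for j
      using elem_le_sum_list[OF that] \<open>sum_list \<nu> < i\<close> by simp
    then show ?thesis by (force simp: conj_part_def)
  qed
  show "?I \<subseteq> {..sum_list lam + sum_list \<mu>}"
  proof
    fix i assume "i \<in> ?I"
    show "i \<in> {..sum_list lam + sum_list \<mu>}"
    proof (rule ccontr)
      assume "\<not> ?thesis"
      then have "sum_list lam < i" "sum_list \<mu> < i" by auto
      with \<open>i \<in> ?I\<close> zero show False by auto
    qed
  qed
qed simp

end

theory Submission
  imports Defs "HOL-Combinatorics.Multiset_Permutations"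
begin

text \<open>
  Symmetrising the definition, $Q_\mu$ in the variables $V$ is, up to the factor $(1-t)^{\ell(\mu)}$,
  the sum over the lists of distinct $y_1, \ldots, y_\ell \in V$ of $y^\mu$ times
  $\prod_a \prod_u (y_a - t u)/(y_a - u)$, where $u$ ranges over the variables of $V$ other than
  $y_1, \ldots, y_a$. Write $x = x_i$. The weight $\phi_{\lambda\mu} x^n$ is a product of local factors
  along the rows, and summing over $\mu_j$ gives the geometric sums
  $y_j^{\lambda_j} (y_j - t x)/(y_j - x) + x^{\lambda_j - \lambda_{j+1}} y_j^{\lambda_{j+1}} (x - t y_j)/(x - y_j)$
  together with corrections for $\mu_j = \mu_{j+1} = \lambda_{j+1}$. After expansion, each word in
  the two kinds of summands in which the second kind is followed by the first is killed
  by antisymmetry in $y_j, y_{j+1}$. In the surviving words $x$ has been inserted at some position of $y$; renaming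
  the variables gives all of them the same monomial $y^\lambda$, and its coefficient vanishes
  by $\sum_{v} v^{N-1} / \prod_{u \ne v} (v - u) = 1$, applied to two sets of variables.
\<close>

section \<open>Partial fractions\<close>

text \<open>The coefficient \<open>hl_phi\<close> of \<open>lam\<close> with itself is 1, so the
  claim is that the sum over all strips, \<open>\<mu> = lam\<close> included, agrees with
  \<open>t ^ length lam\<close> times the term of \<open>lam\<close> after weighting and summing
  over the omitted variable. Up to the full Vandermonde product, the weight of \<open>x\<close> is
  \<open>x ^ (N - 1) / (\<Prod>u. x - u)\<close>, with \<open>u\<close> over the other variables;
  this is why partial fractions decide the matter. The power of \<open>t\<close> comes from scaling:
  when the variables \<open>W\<close> outside \<open>y\<close> are replaced by their multiples
  \<open>t * w\<close>, the weight at \<open>t * w\<close> gains \<open>N - 1\<close> factors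
  \<open>t\<close> above and \<open>card W - 1\<close> below. The obstacle is that the coefficient
  is not local where rows of \<open>lam\<close> repeat: equal rows share one factor, and a factor is
  lost when the run of boxes goes on in the row above. The parameters \<open>k\<close> and
  \<open>ok\<close> of \<open>gen_phi\<close> carry this information down the rows. They can be
  eliminated again because the dependence on \<open>k\<close> is only through 1 and
  \<open>t ^ k\<close>.\<close>

lemma lagrange_interpolation:
  fixes p :: "'a::field poly"
  assumes S: "finite S" and deg: "degree p < card S"
  shows "poly p y = (\<Sum>s\<in>S. poly p s * (\<Prod>u\<in>S-{s}. (y - u) / (s - u)))"
proof -
  define q where "q = (\<Sum>s\<in>S. smult (poly p s * (\<Prod>u\<in>S-{s}. inverse (s - u))) (\<Prod>u\<in>S-{s}. [:-u, 1:]))"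
  have q: "poly q z = (\<Sum>s\<in>S. poly p s * (\<Prod>u\<in>S-{s}. (z - u) / (s - u)))" for z
    by (simp add: q_def poly_sum poly_prod divide_inverse prod.distrib ac_simps)
  have "degree (\<Prod>u\<in>S-{s}. [:-u, 1:]) < card S" if "s \<in> S" for s
  proof -
    have "degree (\<Prod>u\<in>S-{s}. [:-u, 1:]) \<le> (\<Sum>u\<in>S-{s}. degree [:-u, 1:])"
      using degree_prod_sum_le[of "S - {s}" "\<lambda>u. [:-u, 1:]"] S by (simp add: comp_def)
    also have "\<dots> < card S"
      using that S card_gt_0_iff[of S] by auto
    finally show ?thesis .
  qed
  then have deg_term: "degree (smult c (\<Prod>u\<in>S-{s}. [:-u, 1:])) < card S" if "s \<in> S" for s c
    using that by (meson degree_smult_le le_less_trans)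
  have deg_q: "degree q < card S"
    unfolding q_def by (rule degree_sum_less) (use deg in \<open>simp_all only: deg_term\<close>)
  have eq: "poly p z = poly q z" if z: "z \<in> S" for z
  proof -
    have zero: "(\<Prod>u\<in>S-{s}. (z - u) / (s - u)) = 0" if "s \<in> S - {z}" for s
      using that S z by (intro prod_zero) auto
    have one: "(\<Prod>u\<in>S-{z}. (z - u) / (z - u)) = 1"
      by (rule prod.neutral) auto
    have "poly q z = poly p z * (\<Prod>u\<in>S-{z}. (z - u) / (z - u)) +
        (\<Sum>s\<in>S-{z}. poly p s * (\<Prod>u\<in>S-{s}. (z - u) / (s - u)))"
      unfolding q by (rule sum.remove[OF S z])
    also have "(\<Sum>s\<in>S-{z}. poly p s * (\<Prod>u\<in>S-{s}. (z - u) / (s - u))) = 0"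
      by (intro sum.neutral ballI) (simp only: zero mult_zero_right)
    finally show ?thesis unfolding one by simp
  qed
  have "p = q"
    by (intro poly_eqI_degree[of S p q] deg deg_q eq)
  then have "poly p y = poly q y" by (rule arg_cong)
  also note q
  finally show ?thesis .
qed

text \<open>Both products are monic of degree \<open>card S\<close>, so their leading terms cancel.
  This brings the numerators below within reach of \<open>lagrange_interpolation\<close>. For empty
  \<open>S\<close> the difference is 0, whose degree 0 is not less than
  \<open>card S\<close>.\<close>

lemma degree_monic_diff_less:
  fixes f g :: "'b \<Rightarrow> 'a::field"
  assumes S: "finite S" and "S \<noteq> {}"
  shows "degree ((\<Prod>w\<in>S. [:-f w, 1:]) - (\<Prod>w\<in>S. [:-g w, 1:])) < card S"
proof -
  have "degree (\<Prod>w\<in>S. [:-h w, 1:]) = card S \<and> lead_coeff (\<Prod>w\<in>S. [:-h w, 1:]) = 1"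
    for h :: "'b \<Rightarrow> 'a"
    by (subst lead_coeff_prod, subst degree_prod_eq_sum_degree) auto
  from this[of f] this[of g] have "coeff ((\<Prod>w\<in>S. [:-f w, 1:]) - (\<Prod>w\<in>S. [:-g w, 1:])) (card S) = 0"
    and "degree ((\<Prod>w\<in>S. [:-f w, 1:]) - (\<Prod>w\<in>S. [:-g w, 1:])) \<le> card S"
    by (auto intro: degree_diff_le)
  then show ?thesis
    using S \<open>S \<noteq> {}\<close>
    by (metis card_gt_0_iff degree_0 leading_coeff_0_iff le_neq_implies_less)
qed

lemma prod_remove_divide:
  fixes f :: "'b \<Rightarrow> 'a::field"
  assumes "finite S" "s \<in> S" "f s \<noteq> 0"
  shows "prod f (S - {s}) = prod f S / f s"
  using assms by (simp add: prod.remove)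

text \<open>The part of the Hall-Littlewood kernel that involves \<open>y\<close> when
  \<open>y\<close> is placed before all variables of \<open>U\<close>.\<close>

definition cross :: "'a::field \<Rightarrow> 'a \<Rightarrow> 'a set \<Rightarrow> 'a" where
  "cross t y U = (\<Prod>u\<in>U. (y - t * u) / (y - u))"

text \<open>A partial fraction expansion in \<open>y\<close>: \<open>cross t y W\<close> tends to 1
  at infinity and has a simple pole at each \<open>w\<close>, with residue
  \<open>(1 - t) * w * cross t w (W - {w})\<close>.\<close>

lemma sum_cross_residues:
  fixes t :: "'a::field"
  assumes W: "finite W" and y: "y \<notin> W"
  shows "(\<Sum>w\<in>W. (1 - t) * w / (y - w) * cross t w (W - {w})) = cross t y W - 1"
proof (cases "W = {}")
  case False
  \<comment> \<open>The numerator of \<open>cross t y W - 1\<close>; its second product vanishes at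
    the nodes.\<close>
  define p where "p = (\<Prod>w\<in>W. [:-(t * w), 1:]) - (\<Prod>w\<in>W. [:-w, 1:])"
  have ev: "poly p z = (\<Prod>w\<in>W. z - t * w) - (\<Prod>w\<in>W. z - w)" for z
    by (simp add: p_def poly_prod)
  have nz: "(\<Prod>w\<in>W. y - w) \<noteq> 0" using W y by auto
  have "cross t y W - 1 = poly p y / (\<Prod>w\<in>W. y - w)"
    unfolding ev cross_def prod_dividef using nz by (simp add: diff_divide_distrib)
  also have "poly p y = (\<Sum>s\<in>W. poly p s * (\<Prod>u\<in>W-{s}. (y - u) / (s - u)))"
    unfolding p_def by (rule lagrange_interpolation[OF W degree_monic_diff_less[OF W False]])
  also have "\<dots> / (\<Prod>w\<in>W. y - w) = (\<Sum>w\<in>W. (1 - t) * w / (y - w) * cross t w (W - {w}))"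
    unfolding sum_divide_distrib
  proof (rule sum.cong[OF refl])
    fix w assume w: "w \<in> W"
    then have p: "poly p w = (w - t * w) * (\<Prod>u\<in>W-{w}. w - t * u)"
      using W by (simp add: ev prod.remove)
    have yw: "y - w \<noteq> 0" using w y by auto
    have Y: "(\<Prod>u\<in>W-{w}. y - u) = (\<Prod>w\<in>W. y - w) / (y - w)"
      by (rule prod_remove_divide[OF W w]) (rule yw)
    have p': "poly p w = (1 - t) * w * (\<Prod>u\<in>W-{w}. w - t * u)"
      unfolding p by (simp only: left_diff_distrib mult_1_left)
    have alg: "k * A * (B / d / c) / B = k / d * (A / c)" if "B \<noteq> 0" for k A B c d :: 'a
      using that by simp
    show "poly p w * (\<Prod>u\<in>W-{w}. (y - u) / (w - u)) / (\<Prod>w\<in>W. y - w) =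
        (1 - t) * w / (y - w) * cross t w (W - {w})"
      unfolding cross_def prod_dividef p' Y by (rule alg[OF nz])
  qed
  finally show ?thesis by simp
qed (simp add: cross_def)

text \<open>The polynomial of degree less than \<open>card V\<close> that agrees with
  \<open>z ^ card V\<close> on \<open>V\<close> is interpolated and evaluated at 0. At the node
  \<open>v\<close> the product of the other \<open>- u\<close> is \<open>D / (- v)\<close>, which
  lowers the exponent to \<open>card V - 1\<close>.\<close>

lemma sum_power_residues:
  fixes V :: "'a::field set"
  assumes V: "finite V" "V \<noteq> {}" and 0: "0 \<notin> V"
  shows "(\<Sum>v\<in>V. v ^ (card V - 1) / (\<Prod>u\<in>V-{v}. v - u)) = 1"
proof -
  \<comment> \<open>The factors \<open>[:-0, 1:]\<close> bring \<open>z ^ card V\<close> into the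
    form required by \<open>degree_monic_diff_less\<close>.\<close>
  define p where "p = (\<Prod>w\<in>V. [:-0, 1:]) - (\<Prod>w\<in>V. [:-w, 1:])"
  have ev: "poly p z = z ^ card V - (\<Prod>w\<in>V. z - w)" for z
    by (simp add: p_def poly_prod poly_power)
  define D where "D = (\<Prod>w\<in>V. - w)"
  have D: "D \<noteq> 0" using 0 V by (auto simp: D_def)
  have "- D = poly p 0" using V by (simp add: ev D_def card_gt_0_iff)
  also have "\<dots> = (\<Sum>s\<in>V. poly p s * (\<Prod>u\<in>V-{s}. (0 - u) / (s - u)))"
    unfolding p_def by (rule lagrange_interpolation[OF V(1) degree_monic_diff_less[OF V]])
  also have "\<dots> = (\<Sum>v\<in>V. - D * (v ^ (card V - 1) / (\<Prod>u\<in>V-{v}. v - u)))"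
  proof (rule sum.cong[OF refl])
    fix v assume v: "v \<in> V"
    have "poly p v = v ^ card V" using v V by (auto simp: ev)
    also have "\<dots> = v * v ^ (card V - 1)"
      using V by (metis card_gt_0_iff power_eq_if not_gr0)
    finally have "poly p v = v * v ^ (card V - 1)" .
    moreover have "v \<noteq> 0" using v 0 by auto
    moreover have "(\<Prod>u\<in>V-{v}. - u) = D / (- v)"
      unfolding D_def by (rule prod_remove_divide[OF V(1) v]) (use \<open>v \<noteq> 0\<close> in simp)
    ultimately have "poly p v * (\<Prod>u\<in>V-{v}. - u) = - D * v ^ (card V - 1)" by simp
    then show "poly p v * (\<Prod>u\<in>V-{v}. (0 - u) / (v - u)) =
        - D * (v ^ (card V - 1) / (\<Prod>u\<in>V-{v}. v - u))"
      by (simp only: prod_dividef diff_0 times_divide_eq_right)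
  qed
  also have "\<dots> = - D * (\<Sum>v\<in>V. v ^ (card V - 1) / (\<Prod>u\<in>V-{v}. v - u))"
    by (rule sum_distrib_left[symmetric])
  finally show ?thesis using D by simp
qed

text \<open>Put \<open>y = 0\<close> in \<open>sum_cross_residues\<close>: every factor of
  \<open>cross t 0 W\<close> is then \<open>t\<close>. The quotients on the right are the factors of
  \<open>hl_v\<close>.\<close>

lemma sum_cross_eq_qint:
  fixes t :: "'a::field"
  assumes W: "finite W" and 0: "0 \<notin> W" and t: "t \<noteq> 1"
  shows "(\<Sum>w\<in>W. cross t w (W - {w})) = (1 - t ^ card W) / (1 - t)"
proof -
  have "cross t 0 W = (\<Prod>w\<in>W. t)"
    unfolding cross_def using 0 by (intro prod.cong) auto
  then have "cross t 0 W = t ^ card W" by simp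
  then have "t ^ card W - 1 = (\<Sum>w\<in>W. (1 - t) * w / (0 - w) * cross t w (W - {w}))"
    using sum_cross_residues[OF W 0, of t] by simp
  also have "\<dots> = (\<Sum>w\<in>W. - (1 - t) * cross t w (W - {w}))"
  proof (rule sum.cong[OF refl])
    fix w assume "w \<in> W"
    then have "w \<noteq> 0" using 0 by auto
    then show "(1 - t) * w / (0 - w) * cross t w (W - {w}) = - (1 - t) * cross t w (W - {w})"
      by simp
  qed
  finally have "t ^ card W - 1 = - (1 - t) * (\<Sum>w\<in>W. cross t w (W - {w}))"
    by (simp only: sum_distrib_left)
  then show ?thesis using t by (simp add: field_simps)
qed

text \<open>
  By \<open>sum_cross_residues\<close> the left-hand side is the difference of the sums in
  \<open>sum_power_residues\<close> for the sets \<open>Y \<union> W\<close> and \<open>Y \<union> t W\<close>.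
\<close>

lemma residue_cancellation:
  fixes t :: "'a::field"
  assumes fin: "finite Y" "finite W" and W: "W \<noteq> {}" and disj: "Y \<inter> W = {}"
    and 0: "0 \<notin> Y \<union> W" and t: "t \<noteq> 0"
    and tne: "\<And>u v. u \<in> Y \<union> W \<Longrightarrow> v \<in> Y \<union> W \<Longrightarrow> u \<noteq> t * v"
    and c: "\<And>v. c v = v ^ (card (Y \<union> W) - 1) / (\<Prod>u\<in>Y\<union>W-{v}. v - u)"
  shows "(\<Sum>w\<in>W. c w - t ^ card Y * c w / (\<Prod>y\<in>Y. (y - t * w) / (y - w)))
    + (\<Sum>y\<in>Y. c y / cross t y W * (\<Sum>w\<in>W. (1 - t) * w / (y - w) * cross t w (W - {w}))) = 0"
proof -
  let ?n = "card (Y \<union> W)"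
  define V' where "V' = Y \<union> (*) t ` W"
  have inj: "inj_on ((*) t) W" using t by (auto simp: inj_on_def)
  have disj': "Y \<inter> (*) t ` W = {}" using tne by auto
  have card': "card V' = ?n"
    using fin disj disj' inj by (simp add: V'_def card_Un_disjoint card_image)
  have n: "?n = card Y + card W" using fin disj by (simp add: card_Un_disjoint)
  have k: "card W > 0" using W fin by (simp add: card_gt_0_iff)
  have one: "(\<Sum>w\<in>W. c w) + (\<Sum>y\<in>Y. c y) = 1"
    using sum_power_residues[of "Y \<union> W"] fin W 0 disj
    by (simp add: c sum.union_disjoint add.commute)
  have "1 = (\<Sum>v\<in>V'. v ^ (card V' - 1) / (\<Prod>u\<in>V'-{v}. v - u))"
    using 0 t fin W by (intro sum_power_residues[symmetric]) (auto simp: V'_def)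
  also have "\<dots> = (\<Sum>y\<in>Y. y ^ (?n - 1) / (\<Prod>u\<in>V'-{y}. y - u))
       + (\<Sum>w\<in>W. (t * w) ^ (?n - 1) / (\<Prod>u\<in>V'-{t * w}. t * w - u))"
    unfolding card' using fin disj' inj
    by (simp add: V'_def sum.union_disjoint sum.reindex)
  also have "(\<Sum>y\<in>Y. y ^ (?n - 1) / (\<Prod>u\<in>V'-{y}. y - u)) = (\<Sum>y\<in>Y. c y / cross t y W)"
  proof (rule sum.cong[OF refl])
    fix y assume y: "y \<in> Y"
    have "V' - {y} = (Y - {y}) \<union> (*) t ` W" "Y \<union> W - {y} = (Y - {y}) \<union> W"
      using y disj disj' by (auto simp: V'_def)
    moreover have "(Y - {y}) \<inter> (*) t ` W = {}" "(Y - {y}) \<inter> W = {}"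
      using disj disj' by auto
    moreover have "(\<Prod>w\<in>W. y - w) \<noteq> 0" "(\<Prod>w\<in>W. y - t * w) \<noteq> 0"
      using y disj tne fin by auto
    ultimately show "y ^ (?n - 1) / (\<Prod>u\<in>V'-{y}. y - u) = c y / cross t y W"
      using fin inj
      by (simp add: c cross_def prod_dividef prod.union_disjoint prod.reindex)
  qed
  also have "(\<Sum>w\<in>W. (t * w) ^ (?n - 1) / (\<Prod>u\<in>V'-{t * w}. t * w - u)) =
      (\<Sum>w\<in>W. t ^ card Y * c w / (\<Prod>y\<in>Y. (y - t * w) / (y - w)))"
  proof (rule sum.cong[OF refl])
    fix w assume w: "w \<in> W"
    have "V' - {t * w} = Y \<union> (*) t ` (W - {w})" "Y \<union> W - {w} = Y \<union> (W - {w})"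
      using w disj disj' t by (auto simp: V'_def)
    moreover have "Y \<inter> (*) t ` (W - {w}) = {}" "Y \<inter> (W - {w}) = {}"
      using disj disj' by auto
    moreover have inj': "inj_on ((*) t) (W - {w})" using inj by (rule inj_on_subset) auto
    ultimately have P1: "(\<Prod>u\<in>V'-{t * w}. t * w - u) = (\<Prod>y\<in>Y. t * w - y) * (\<Prod>u\<in>W-{w}. t * w - t * u)"
      and P2: "(\<Prod>u\<in>Y\<union>W-{w}. w - u) = (\<Prod>y\<in>Y. w - y) * (\<Prod>u\<in>W-{w}. w - u)"
      using fin by (simp_all add: prod.union_disjoint prod.reindex)
    have P3: "(\<Prod>u\<in>W-{w}. t * w - t * u) = t ^ (card W - 1) * (\<Prod>u\<in>W-{w}. w - u)"
      using w fin by (simp add: right_diff_distrib[symmetric] prod.distrib)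
    have P4: "(\<Prod>y\<in>Y. (y - t * w) / (y - w)) = (\<Prod>y\<in>Y. t * w - y) / (\<Prod>y\<in>Y. w - y)"
      unfolding prod_dividef[symmetric] by (intro prod.cong refl) (simp only: minus_divide_divide[symmetric, of "_ - t * w"] minus_diff_eq)
    have nz: "(\<Prod>y\<in>Y. w - y) \<noteq> 0" "(\<Prod>y\<in>Y. t * w - y) \<noteq> 0" "(\<Prod>u\<in>W-{w}. w - u) \<noteq> 0"
      using w fin disj tne[of _ w] by auto
    \<comment> \<open>Of the \<open>?n - 1\<close> factors \<open>t\<close> in the numerator,
      \<open>P3\<close> cancels \<open>card W - 1\<close>; the remaining \<open>t ^ card Y\<close>
      becomes \<open>t ^ length lam\<close> in the theorem.\<close>
    have "?n - 1 = card Y + (card W - 1)" using n k by simp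
    then show "(t * w) ^ (?n - 1) / (\<Prod>u\<in>V'-{t * w}. t * w - u) =
        t ^ card Y * c w / (\<Prod>y\<in>Y. (y - t * w) / (y - w))"
      using nz t by (simp add: c P1 P2 P3 P4 power_mult_distrib power_add)
  qed
  finally have one': "(\<Sum>w\<in>W. t ^ card Y * c w / (\<Prod>y\<in>Y. (y - t * w) / (y - w))) +
      (\<Sum>y\<in>Y. c y / cross t y W) = 1" by (simp only: add.commute)
  have "(\<Sum>y\<in>Y. c y / cross t y W * (\<Sum>w\<in>W. (1 - t) * w / (y - w) * cross t w (W - {w})))
      = (\<Sum>y\<in>Y. c y - c y / cross t y W)"
  proof (rule sum.cong[OF refl])
    fix y assume y: "y \<in> Y"
    then have "cross t y W \<noteq> 0" using fin disj tne by (auto simp: cross_def)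
    moreover have "y \<notin> W" using y disj by auto
    ultimately show "c y / cross t y W * (\<Sum>w\<in>W. (1 - t) * w / (y - w) * cross t w (W - {w}))
        = c y - c y / cross t y W"
      unfolding sum_cross_residues[OF fin(2) \<open>y \<notin> W\<close>] by (simp add: right_diff_distrib)
  qed
  then show ?thesis
    by (simp only: sum_subtractf add_diff_add[symmetric] one one' diff_self)
qed

section \<open>Hall-Littlewood symmetrisation over a finite set of variables\<close>

text \<open>
  The variables of the set \<open>V\<close> that do not occur in the list are the arguments with
  exponent 0; symmetrising over them only contributes a constant, so they are left out.
\<close>

primrec symsum :: "'a::field \<Rightarrow> nat \<Rightarrow> 'a set \<Rightarrow> ('a list \<Rightarrow> 'a) \<Rightarrow> 'a" where
  "symsum t 0 V f = f []"
| "symsum t (Suc k) V f = (\<Sum>y\<in>V. cross t y (V - {y}) * symsum t k (V - {y}) (\<lambda>ys. f (y # ys)))"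

lemma symsum_cong:
  assumes "\<And>ys. length ys = k \<Longrightarrow> distinct ys \<Longrightarrow> set ys \<subseteq> V \<Longrightarrow> f ys = g ys"
  shows "symsum t k V f = symsum t k V g"
  using assms
proof (induction k arbitrary: V f g)
  case (Suc k)
  have "symsum t k (V - {y}) (\<lambda>ys. f (y # ys)) = symsum t k (V - {y}) (\<lambda>ys. g (y # ys))"
    if "y \<in> V" for y
    using that by (intro Suc.IH Suc.prems) auto
  then show ?case by simp
qed simp

lemma symsum_cmult: "symsum t k V (\<lambda>ys. c * f ys) = c * symsum t k V f"
  by (induction k arbitrary: V f) (simp_all add: sum_distrib_left ac_simps)

lemma symsum_add: "symsum t k V (\<lambda>ys. f ys + g ys) = symsum t k V f + symsum t k V g"
  by (induction k arbitrary: V f g) (simp_all add: sum.distrib distrib_left)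

lemma symsum_diff: "symsum t k V (\<lambda>ys. f ys - g ys) = symsum t k V f - symsum t k V g"
  by (induction k arbitrary: V f g) (simp_all add: sum_subtractf right_diff_distrib)

lemma symsum_zero: "symsum t k V (\<lambda>ys. 0) = 0"
  by (induction k arbitrary: V) simp_all

lemma symsum_sum: "symsum t k V (\<lambda>ys. \<Sum>i\<in>I. f i ys) = (\<Sum>i\<in>I. symsum t k V (f i))"
  by (induction I rule: infinite_finite_induct) (simp_all add: symsum_zero symsum_add)

section \<open>Exchanging and renaming variables in symmetrised sums\<close>

lemma sum_ordered_pairs_swap:
  assumes "finite V"
  shows "(\<Sum>x\<in>V. \<Sum>y\<in>V - {x}. g x y) = (\<Sum>y\<in>V. \<Sum>x\<in>V - {y}. g x y)"
proof -
  have "(\<Sum>x\<in>V. \<Sum>y\<in>V - {x}. g x y) = (\<Sum>x\<in>V. \<Sum>y\<in>{y\<in>V. x \<noteq> y}. g x y)"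
    by (intro sum.cong) auto
  also have "\<dots> = (\<Sum>y\<in>V. \<Sum>x\<in>{x\<in>V. x \<noteq> y}. g x y)"
    by (rule sum.swap_restrict[OF assms assms])
  also have "\<dots> = (\<Sum>y\<in>V. \<Sum>x\<in>V - {y}. g x y)"
    by (intro sum.cong) auto
  finally show ?thesis .
qed

lemma cross_remove:
  assumes "finite U" "x \<in> U"
  shows "cross t y U = (y - t * x) / (y - x) * cross t y (U - {x})"
  using assms by (simp add: cross_def prod.remove)

lemma cross_split:
  assumes "finite U" "A \<subseteq> U"
  shows "cross t y U = cross t y A * cross t y (U - A)"
  unfolding cross_def by (subst prod.subset_diff[OF assms(2,1)]) (rule mult.commute)

lemma cross_nonzero:
  assumes "finite U" "\<And>u. u \<in> U \<Longrightarrow> y \<noteq> u \<and> y \<noteq> t * u"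
  shows "cross t y U \<noteq> 0"
  using assms by (auto simp: cross_def)

text \<open>Splits off the last entry instead of the first. It serves
  \<open>sum_symsum_rotate\<close>, where a variable enters at the front and another one leaves at
  the end.\<close>

lemma symsum_Suc_append:
  assumes "finite V"
  shows "symsum t (Suc k) V g =
    symsum t k V (\<lambda>ys. \<Sum>w\<in>V - set ys. cross t w (V - set ys - {w}) * g (ys @ [w]))"
  using assms
proof (induction k arbitrary: V g)
  case (Suc k)
  have eq: "V - {y} - set ys = V - set (y # ys)" for y ys by auto
  have "symsum t (Suc (Suc k)) V g =
      (\<Sum>y\<in>V. cross t y (V - {y}) * symsum t (Suc k) (V - {y}) (\<lambda>ys. g (y # ys)))"
    by (rule symsum.simps(2))
  also have "\<dots> = symsum t (Suc k) V (\<lambda>ys. \<Sum>w\<in>V - set ys. cross t w (V - set ys - {w}) * g (ys @ [w]))"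
    unfolding Suc.IH[OF finite_Diff[OF Suc.prems]] eq by simp
  finally show ?case .
qed simp

text \<open>Exchanging the first two variables changes only their mutual factor in the
  \<open>cross\<close> products and \<open>g\<close>; everything else is symmetric in the two. By
  \<open>anti\<close> the terms cancel in pairs, so twice the sum is 0.\<close>

lemma symsum_swap_zero:
  assumes V: "finite V" and two: "(2::'a::field) \<noteq> 0"
    and anti: "\<And>y z. y \<in> V \<Longrightarrow> z \<in> V \<Longrightarrow> y \<noteq> z \<Longrightarrow>
      (y - t * z) / (y - z) * g y z + (z - t * y) / (z - y) * g z y = 0"
  shows "symsum t (Suc (Suc k)) V (\<lambda>ys. g (hd ys) (hd (tl ys)) * f (tl (tl ys))) = (0::'a)"
    (is "?s = 0")
proof -
  define h where "h y z = cross t y (V - {y}) * (cross t z (V - {y} - {z}) *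
      (g y z * symsum t k (V - {y} - {z}) f))" for y z
  have s: "?s = (\<Sum>y\<in>V. \<Sum>z\<in>V - {y}. h y z)"
    by (simp add: h_def symsum_cmult sum_distrib_left)
  have "h y z + h z y = 0" if "y \<in> V" "z \<in> V - {y}" for y z
  proof -
    have eq: "V - {z} - {y} = V - {y} - {z}" by auto
    have yz: "y \<in> V" "z \<in> V" "y \<noteq> z" using that by auto
    have cy: "cross t y (V - {y}) = (y - t * z) / (y - z) * cross t y (V - {y} - {z})"
      using V yz by (intro cross_remove) auto
    have cz: "cross t z (V - {z}) = (z - t * y) / (z - y) * cross t z (V - {y} - {z})"
      unfolding eq[symmetric] using V yz by (intro cross_remove) auto
    have "h y z + h z y = ((y - t * z) / (y - z) * g y z + (z - t * y) / (z - y) * g z y) *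
        (cross t y (V - {y} - {z}) * cross t z (V - {y} - {z}) * symsum t k (V - {y} - {z}) f)"
      unfolding h_def eq cy cz by (subst distrib_right) (simp only: ac_simps)
    then show ?thesis unfolding anti[OF yz] by simp
  qed
  then have "?s + (\<Sum>y\<in>V. \<Sum>z\<in>V - {y}. h z y) = 0"
    unfolding s sum.distrib[symmetric] by (intro sum.neutral ballI)
  moreover have "(\<Sum>y\<in>V. \<Sum>z\<in>V - {y}. h z y) = ?s"
    unfolding s using sum_ordered_pairs_swap[OF V, of h] by simp
  ultimately have "2 * ?s = 0" by simp
  then show ?thesis using two by simp
qed

text \<open>Puts the omitted variable back into the pool. Each entry \<open>y\<close> of
  \<open>ys\<close> thereby acquires the factor \<open>(y - t * x) / (y - x)\<close>, non-zero by
  \<open>res\<close>, which has to be divided out; the former \<open>x\<close> runs over the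
  variables not in \<open>ys\<close>.\<close>

lemma sum_symsum_remove:
  assumes V: "finite V" and res: "\<And>u v. u \<in> V \<Longrightarrow> v \<in> V \<Longrightarrow> u \<noteq> t * v"
  shows "(\<Sum>x\<in>V. symsum t k (V - {x}) (f x)) =
    symsum t k V (\<lambda>ys. \<Sum>w\<in>V - set ys. f w ys / (\<Prod>y\<in>set ys. (y - t * w) / (y - w)))"
  using assms
proof (induction k arbitrary: V f)
  case (Suc k)
  have "(\<Sum>x\<in>V. symsum t (Suc k) (V - {x}) (f x)) =
     (\<Sum>y\<in>V. \<Sum>x\<in>V-{y}. cross t y (V - {x} - {y}) * symsum t k (V - {x} - {y}) (\<lambda>ys. f x (y # ys)))"
    unfolding symsum.simps(2) by (rule sum_ordered_pairs_swap[OF Suc.prems(1)])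
  also have "\<dots> = (\<Sum>y\<in>V. cross t y (V - {y}) *
     (\<Sum>x\<in>V-{y}. symsum t k (V - {y} - {x}) (\<lambda>ys. 1 / ((y - t * x) / (y - x)) * f x (y # ys))))"
    unfolding sum_distrib_left
  proof (intro sum.cong refl)
    fix x y assume xy: "y \<in> V" "x \<in> V - {y}"
    have eq: "V - {x} - {y} = V - {y} - {x}" by auto
    have "(y - t * x) / (y - x) \<noteq> 0" using xy Suc.prems(2)[of y x] by auto
    then show "cross t y (V - {x} - {y}) * symsum t k (V - {x} - {y}) (\<lambda>ys. f x (y # ys)) =
      cross t y (V - {y}) * symsum t k (V - {y} - {x}) (\<lambda>ys. 1 / ((y - t * x) / (y - x)) * f x (y # ys))"
      using xy Suc.prems(1) cross_remove[of "V - {y}" x t y] unfolding eq symsum_cmult by simp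
  qed
  also have "\<dots> = (\<Sum>y\<in>V. cross t y (V - {y}) *
     symsum t k (V - {y}) (\<lambda>ys. \<Sum>w\<in>V - set (y # ys). f w (y # ys) /
       (\<Prod>z\<in>set (y # ys). (z - t * w) / (z - w))))"
  proof (intro sum.cong refl arg_cong2[where f = "(*)"])
    fix y assume "y \<in> V"
    have "(\<Sum>x\<in>V-{y}. symsum t k (V - {y} - {x}) (\<lambda>ys. 1 / ((y - t * x) / (y - x)) * f x (y # ys))) =
      symsum t k (V - {y}) (\<lambda>ys. \<Sum>w\<in>V - {y} - set ys. 1 / ((y - t * w) / (y - w)) * f w (y # ys) /
       (\<Prod>z\<in>set ys. (z - t * w) / (z - w)))"
      by (rule Suc.IH) (use Suc.prems in auto)
    also have "\<dots> = symsum t k (V - {y}) (\<lambda>ys. \<Sum>w\<in>V - set (y # ys). f w (y # ys) /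
       (\<Prod>z\<in>set (y # ys). (z - t * w) / (z - w)))"
    proof (intro symsum_cong sum.cong)
      fix ys w assume "set ys \<subseteq> V - {y}"
      then have "(\<Prod>z\<in>set (y # ys). (z - t * w) / (z - w)) =
          (y - t * w) / (y - w) * (\<Prod>z\<in>set ys. (z - t * w) / (z - w))"
        by (subst list.set(2), subst prod.insert) auto
      then show "1 / ((y - t * w) / (y - w)) * f w (y # ys) / (\<Prod>z\<in>set ys. (z - t * w) / (z - w)) =
          f w (y # ys) / (\<Prod>z\<in>set (y # ys). (z - t * w) / (z - w))" by simp
    qed auto
    finally show "(\<Sum>x\<in>V-{y}. symsum t k (V - {y} - {x}) (\<lambda>ys. 1 / ((y - t * x) / (y - x)) * f x (y # ys))) = \<dots>" .
  qed
  finally show ?case by simp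
qed simp

text \<open>A renaming: the omitted \<open>x\<close> becomes the first entry of the list, and the
  last entry is released as \<open>w\<close>. The division removes the \<open>cross\<close> factor
  that \<open>x\<close> receives as a first entry but did not have before.\<close>

lemma sum_symsum_rotate:
  assumes V: "finite V" and res: "\<And>u v. u \<in> V \<Longrightarrow> v \<in> V \<Longrightarrow> u \<noteq> t * v"
  shows "(\<Sum>x\<in>V. symsum t (Suc k) (V - {x}) (f x)) =
    symsum t (Suc k) V (\<lambda>zs. \<Sum>w\<in>V - set zs. cross t w (V - set zs - {w}) *
      f (hd zs) (tl zs @ [w]) / cross t (hd zs) (V - {hd zs}))"
proof -
  have "symsum t (Suc k) (V - {x}) (f x) = cross t x (V - {x}) *
      symsum t k (V - {x}) (\<lambda>ys. \<Sum>w\<in>V - set (x # ys). cross t w (V - set (x # ys) - {w}) *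
      f x (ys @ [w]) / cross t x (V - {x}))" if "x \<in> V" for x
  proof -
    have nz: "cross t x (V - {x}) \<noteq> 0"
      using that res V by (intro cross_nonzero) auto
    have eq: "V - {x} - set ys = V - set (x # ys)" for ys by auto
    show ?thesis
      unfolding symsum_Suc_append[OF finite_Diff[OF V]] eq symsum_cmult[symmetric] sum_distrib_left
      using nz by simp
  qed
  then show ?thesis by simp
qed

subsection \<open>Comparison with the definition of the Hall-Littlewood polynomials\<close>

text \<open>Kept general in \<open>g\<close> because it serves for the Hall-Littlewood kernel and
  for the Vandermonde product.\<close>

definition pair_prod :: "('a \<Rightarrow> 'a \<Rightarrow> 'b::comm_monoid_mult) \<Rightarrow> 'a list \<Rightarrow> 'b" where
  "pair_prod g xs = (\<Prod>(i, j) | i < j \<and> j < length xs. g (xs ! i) (xs ! j))"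

lemma pair_prod_Nil: "pair_prod g [] = 1"
  by (simp add: pair_prod_def)

lemma pair_prod_Cons: "pair_prod g (x # xs) = prod_list (map (g x) xs) * pair_prod g xs"
proof -
  let ?I = "\<lambda>n. {(i, j). i < j \<and> j < (n::nat)}"
  have fin: "finite (?I n)" for n by (rule finite_subset[of _ "{..<n} \<times> {..<n}"]) auto
  have "?I (length (x # xs)) = (\<lambda>j. (0, Suc j)) ` {..<length xs} \<union> map_prod Suc Suc ` ?I (length xs)"
  proof (intro equalityI subsetI)
    fix p assume "p \<in> ?I (length (x # xs))"
    then show "p \<in> (\<lambda>j. (0, Suc j)) ` {..<length xs} \<union> map_prod Suc Suc ` ?I (length xs)"
      by (cases p; cases "fst p"; cases "snd p") (auto simp: image_iff)
  qed auto
  then have "pair_prod g (x # xs) =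
      (\<Prod>(i, j)\<in>(\<lambda>j. (0, Suc j)) ` {..<length xs}. g ((x # xs) ! i) ((x # xs) ! j)) *
      (\<Prod>(i, j)\<in>map_prod Suc Suc ` ?I (length xs). g ((x # xs) ! i) ((x # xs) ! j))"
    unfolding pair_prod_def by (simp only:) (intro prod.union_disjoint, use fin in auto)
  also have "(\<Prod>(i, j)\<in>(\<lambda>j. (0, Suc j)) ` {..<length xs}. g ((x # xs) ! i) ((x # xs) ! j)) =
      prod_list (map (g x) xs)"
    by (subst prod.reindex) (auto simp: inj_on_def prod.list_conv_set_nth atLeast0LessThan)
  also have "(\<Prod>(i, j)\<in>map_prod Suc Suc ` ?I (length xs). g ((x # xs) ! i) ((x # xs) ! j)) =
      pair_prod g xs"
    unfolding pair_prod_def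
    by (subst prod.reindex) (auto simp: inj_on_def intro!: prod.cong)
  finally show ?thesis .
qed

text \<open>The factor \<open>cross t y (V - {y})\<close> in the recursion collects all pairs whose
  earlier entry is \<open>y\<close>, so that these factors multiply to the pair product.\<close>

lemma symsum_eq_sum_permutations:
  assumes "finite A"
  shows "symsum t (card A) A f =
    (\<Sum>ys\<in>permutations_of_set A. pair_prod (\<lambda>u v. (u - t * v) / (u - v)) ys * f ys)"
  using assms
proof (induction "card A" arbitrary: A f)
  case 0
  then show ?case by (simp add: pair_prod_Nil)
next
  case (Suc n)
  let ?P = "pair_prod (\<lambda>u v. (u - t * v) / (u - v))"
  have A: "A \<noteq> {}" and n: "n = card (A - {x})" if "x \<in> A" for x
    using Suc that by auto
  have ne: "A \<noteq> {}" using Suc by auto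
  have "symsum t (card A) A f =
      (\<Sum>x\<in>A. cross t x (A - {x}) * symsum t n (A - {x}) (\<lambda>ys. f (x # ys)))"
    unfolding Suc.hyps(2)[symmetric] by simp
  also have "\<dots> = (\<Sum>x\<in>A. cross t x (A - {x}) *
      (\<Sum>ys\<in>permutations_of_set (A - {x}). ?P ys * f (x # ys)))"
    using n Suc.hyps(1)[OF n] Suc.prems by (intro sum.cong) auto
  also have "\<dots> = (\<Sum>x\<in>A. \<Sum>ys\<in>(#) x ` permutations_of_set (A - {x}). ?P ys * f ys)"
  proof (intro sum.cong refl)
    fix x assume "x \<in> A"
    have "?P (x # ys) = cross t x (A - {x}) * ?P ys" if "ys \<in> permutations_of_set (A - {x})" for ys
      unfolding pair_prod_Cons cross_def permutations_of_setD(1)[OF that, symmetric]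
        prod.distinct_set_conv_list[OF permutations_of_setD(2)[OF that]] ..
    then show "cross t x (A - {x}) * (\<Sum>ys\<in>permutations_of_set (A - {x}). ?P ys * f (x # ys)) =
      (\<Sum>ys\<in>(#) x ` permutations_of_set (A - {x}). ?P ys * f ys)"
      by (simp add: sum.reindex sum_distrib_left mult.assoc)
  qed
  also have "\<dots> = (\<Sum>ys\<in>(\<Union>x\<in>A. (#) x ` permutations_of_set (A - {x})). ?P ys * f ys)"
    using Suc.prems by (intro sum.UNION_disjoint[symmetric]) auto
  finally show ?case unfolding permutations_of_set_nonempty[OF ne] .
qed

lemma sum_permutes_eq_sum_permutations_of_set:
  assumes "distinct xs"
  shows "(\<Sum>\<sigma> | \<sigma> permutes {..<length xs}. F (permute_list \<sigma> xs)) =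
    (\<Sum>ys\<in>permutations_of_set (set xs). F ys)"
proof (rule sum.reindex_bij_betw)
  show "bij_betw (\<lambda>\<sigma>. permute_list \<sigma> xs) {\<sigma>. \<sigma> permutes {..<length xs}} (permutations_of_set (set xs))"
    unfolding bij_betw_def
  proof (intro conjI equalityI subsetI)
    show "inj_on (\<lambda>\<sigma>. permute_list \<sigma> xs) {\<sigma>. \<sigma> permutes {..<length xs}}"
    proof (rule inj_onI)
      fix \<sigma> \<tau> assume *: "\<sigma> \<in> {\<sigma>. \<sigma> permutes {..<length xs}}" "\<tau> \<in> {\<sigma>. \<sigma> permutes {..<length xs}}"
        "permute_list \<sigma> xs = permute_list \<tau> xs"
      show "\<sigma> = \<tau>"
      proof
        fix i show "\<sigma> i = \<tau> i"
        proof (cases "i < length xs")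
          case True
          then have "xs ! \<sigma> i = xs ! \<tau> i"
            using * permute_list_nth[of _ xs i] by (metis mem_Collect_eq)
          moreover have "\<sigma> i < length xs" "\<tau> i < length xs"
            using * True permutes_in_image[of _ "{..<length xs}" i] by auto
          ultimately show ?thesis using assms by (simp add: nth_eq_iff_index_eq)
        next
          case False
          then show ?thesis using * by (auto simp: permutes_def)
        qed
      qed
    qed
  next
    fix ys assume "ys \<in> permutations_of_set (set xs)"
    then have "mset ys = mset xs"
      using assms by (metis permutations_of_setD set_eq_iff_mset_eq_distinct)
    then obtain p where "p permutes {..<length xs}" "permute_list p xs = ys"
      by (rule mset_eq_permutation)
    then show "ys \<in> (\<lambda>\<sigma>. permute_list \<sigma> xs) ` {\<sigma>. \<sigma> permutes {..<length xs}}" by auto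
  qed (auto simp: permutations_of_set_def assms)
qed

primrec monom_eval :: "nat list \<Rightarrow> 'a::comm_monoid_mult list \<Rightarrow> 'a" where
  "monom_eval [] ys = 1"
| "monom_eval (a # l) ys = hd ys ^ a * monom_eval l (tl ys)"

lemma part_Cons: "part (a # \<mu>) 0 = a" "part (a # \<mu>) (Suc j) = part \<mu> j"
  by (simp_all add: part_def)

lemma prod_power_part_eq_monom_eval:
  assumes "length \<mu> \<le> length ys"
  shows "(\<Prod>i<length ys. (ys ! i) ^ part \<mu> i) = monom_eval \<mu> (take (length \<mu>) ys)"
  using assms
proof (induction \<mu> arbitrary: ys)
  case (Cons a \<mu>)
  then obtain y zs where ys: "ys = y # zs" by (cases ys) auto
  then have "(\<Prod>i<length ys. (ys ! i) ^ part (a # \<mu>) i) = y ^ a * (\<Prod>i<length zs. (zs ! i) ^ part \<mu> i)"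
    by (simp add: prod.lessThan_Suc_shift part_Cons del: prod.lessThan_Suc)
  then show ?case using Cons ys by simp
qed (simp add: part_def)

lemma symsum_one:
  assumes "finite V" "0 \<notin> V" "t \<noteq> 1"
  shows "symsum t (card V) V (\<lambda>_. 1) = (\<Prod>j=1..card V. (1 - t ^ j) / (1 - t))"
  using assms
proof (induction "card V" arbitrary: V)
  case (Suc n)
  have "symsum t (card V) V (\<lambda>_. 1) = (\<Sum>y\<in>V. cross t y (V - {y}) * symsum t n (V - {y}) (\<lambda>_. 1))"
    unfolding Suc.hyps(2)[symmetric] by simp
  also have "\<dots> = (\<Sum>y\<in>V. cross t y (V - {y}) * (\<Prod>j=1..n. (1 - t ^ j) / (1 - t)))"
  proof (intro sum.cong refl)
    fix y assume "y \<in> V"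
    then have "n = card (V - {y})" using Suc by simp
    then show "cross t y (V - {y}) * symsum t n (V - {y}) (\<lambda>_. 1) =
        cross t y (V - {y}) * (\<Prod>j=1..n. (1 - t ^ j) / (1 - t))"
      using Suc.hyps(1)[of "V - {y}"] Suc.prems by simp
  qed
  also have "\<dots> = (\<Prod>j=1..n. (1 - t ^ j) / (1 - t)) * ((1 - t ^ card V) / (1 - t))"
    unfolding sum_distrib_right[symmetric] using Suc.prems by (simp add: sum_cross_eq_qint mult.commute)
  finally show ?case unfolding Suc.hyps(2)[symmetric] by simp
qed simp

text \<open>The entries after the first \<open>k\<close> have exponent 0. Summing them out leaves
  \<open>symsum_one\<close> for the remaining variables, which is the factor of \<open>hl_v\<close>
  for the part 0.\<close>

lemma symsum_take:
  assumes "finite V" "0 \<notin> V" "t \<noteq> 1" "k \<le> card V"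
  shows "symsum t (card V) V (\<lambda>ys. f (take k ys)) =
    (\<Prod>j=1..card V - k. (1 - t ^ j) / (1 - t)) * symsum t k V f"
  using assms
proof (induction k arbitrary: V f)
  case 0
  then show ?case using symsum_cmult[of t "card V" V "f []" "\<lambda>_. 1"] by (simp add: symsum_one)
next
  case (Suc k)
  then obtain n where n: "card V = Suc n" by (cases "card V") auto
  have c: "card (V - {y}) = n" if "y \<in> V" for y using n that Suc.prems by simp
  have "symsum t (Suc n) V (\<lambda>ys. f (take (Suc k) ys)) =
      (\<Sum>y\<in>V. cross t y (V - {y}) * symsum t n (V - {y}) (\<lambda>ys. f (y # take k ys)))" by simp
  also have "\<dots> = (\<Sum>y\<in>V. cross t y (V - {y}) *
      ((\<Prod>j=1..n - k. (1 - t ^ j) / (1 - t)) * symsum t k (V - {y}) (\<lambda>ys. f (y # ys))))"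
  proof (intro sum.cong refl arg_cong2[where f = "(*)"])
    fix y assume "y \<in> V"
    then show "symsum t n (V - {y}) (\<lambda>ys. f (y # take k ys)) =
      (\<Prod>j=1..n - k. (1 - t ^ j) / (1 - t)) * symsum t k (V - {y}) (\<lambda>ys. f (y # ys))"
      using Suc.IH[of "V - {y}" "\<lambda>ys. f (y # ys)"] Suc.prems n c by simp
  qed
  finally show ?case by (simp add: n sum_distrib_left ac_simps)
qed

text \<open>The factor of \<open>hl_v\<close> for the part 0 cancels against
  \<open>symsum_take\<close>, and the other factors are \<open>hl_b\<close> divided by one
  \<open>1 - t\<close> per part. Hence the prefactor depends on \<open>length \<mu>\<close> only and
  is common to all \<open>\<mu>\<close> in the theorem.\<close>

lemma hl_Q_eq_symsum:
  assumes xs: "distinct xs" "0 \<notin> set xs" and len: "length \<mu> \<le> length xs"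
    and t: "\<And>j. 0 < j \<Longrightarrow> t ^ j \<noteq> 1"
  shows "hl_Q t \<mu> xs = (1 - t) ^ length \<mu> * symsum t (length \<mu>) (set xs) (monom_eval \<mu>)"
proof -
  let ?n = "length xs"
  let ?P = "pair_prod (\<lambda>u v. (u - t * v) / (u - v))"
  have t1: "t \<noteq> 1" using t[of 1] by simp
  have card: "card (set xs) = ?n" using xs by (simp add: distinct_card)
  have "(\<Sum>\<sigma> | \<sigma> permutes {..<?n}. (\<Prod>i<?n. (xs ! \<sigma> i) ^ part \<mu> i) *
        (\<Prod>(i, j) | i < j \<and> j < ?n. (xs ! \<sigma> i - t * xs ! \<sigma> j) / (xs ! \<sigma> i - xs ! \<sigma> j)))
     = (\<Sum>\<sigma> | \<sigma> permutes {..<?n}. (\<lambda>ys. ?P ys * (\<Prod>i<length ys. (ys ! i) ^ part \<mu> i)) (permute_list \<sigma> xs))"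
    by (intro sum.cong refl)
       (auto simp: pair_prod_def permute_list_nth mult.commute intro!: arg_cong2[where f = "(*)"] prod.cong)
  also have "\<dots> = (\<Sum>ys\<in>permutations_of_set (set xs). ?P ys * (\<Prod>i<length ys. (ys ! i) ^ part \<mu> i))"
    by (rule sum_permutes_eq_sum_permutations_of_set[OF xs(1),
        of "\<lambda>ys. ?P ys * (\<Prod>i<length ys. (ys ! i) ^ part \<mu> i)"])
  also have "\<dots> = symsum t ?n (set xs) (\<lambda>ys. \<Prod>i<length ys. (ys ! i) ^ part \<mu> i)"
    by (simp only: symsum_eq_sum_permutations[of "set xs", OF finite_set, symmetric] card)
  also have "\<dots> = symsum t ?n (set xs) (\<lambda>ys. monom_eval \<mu> (take (length \<mu>) ys))"
    using len by (intro symsum_cong prod_power_part_eq_monom_eval) simp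
  also have "\<dots> = (\<Prod>j=1..?n - length \<mu>. (1 - t ^ j) / (1 - t)) * symsum t (length \<mu>) (set xs) (monom_eval \<mu>)"
    using symsum_take[of "set xs" t "length \<mu>" "monom_eval \<mu>"] xs len t1 by (simp add: card)
  finally have sum: "(\<Sum>\<sigma> | \<sigma> permutes {..<?n}. (\<Prod>i<?n. (xs ! \<sigma> i) ^ part \<mu> i) *
        (\<Prod>(i, j) | i < j \<and> j < ?n. (xs ! \<sigma> i - t * xs ! \<sigma> j) / (xs ! \<sigma> i - xs ! \<sigma> j)))
     = (\<Prod>j=1..?n - length \<mu>. (1 - t ^ j) / (1 - t)) * symsum t (length \<mu>) (set xs) (monom_eval \<mu>)" .
  have nz: "1 - t ^ j \<noteq> 0" if "j \<in> {1..m}" for j m using t[of j] that by auto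
  have "(\<Prod>i\<in>set \<mu>. \<Prod>j=1..count_list \<mu> i. (1 - t ^ j) / (1 - t)) =
      hl_b t \<mu> / (\<Prod>i\<in>set \<mu>. \<Prod>j=1..count_list \<mu> i. 1 - t)"
    by (simp only: prod_dividef hl_b_def)
  also have "(\<Prod>i\<in>set \<mu>. \<Prod>j=1..count_list \<mu> i. 1 - t) = (1 - t) ^ length \<mu>"
    by (simp add: power_sum[symmetric] sum_count_set)
  finally have v: "hl_v t ?n \<mu> = (\<Prod>j=1..?n - length \<mu>. (1 - t ^ j) / (1 - t)) * (hl_b t \<mu> / (1 - t) ^ length \<mu>)"
    by (simp add: hl_v_def)
  have "hl_b t \<mu> \<noteq> 0" "(\<Prod>j=1..?n - length \<mu>. (1 - t ^ j) / (1 - t)) \<noteq> 0"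
    using nz t1 by (auto simp: hl_b_def)
  then show ?thesis
    unfolding hl_Q_def hl_P_def sum v using t1 by (simp add: field_simps)
qed

section \<open>Horizontal strips\<close>

text \<open>The \<open>\<mu>\<close> with as many parts as \<open>lam\<close> such that \<open>lam/\<mu>\<close> is a horizontal strip.\<close>

primrec strip_inner :: "nat list \<Rightarrow> nat list set" where
  "strip_inner [] = {[]}"
| "strip_inner (a # l) = (\<Union>m\<in>{(if l = [] then 1 else hd l)..a}. (#) m ` strip_inner l)"

text \<open>For a horizontal strip the two differences are 0 or 1, so these are the columns with a
  box of the strip whose right neighbour has none.\<close>

definition strip_ends :: "nat list \<Rightarrow> nat list \<Rightarrow> nat set" where
  "strip_ends lam \<mu> = {i. 1 \<le> i \<and> int (conj_part lam i) - int (conj_part \<mu> i)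
                       > int (conj_part lam (i + 1)) - int (conj_part \<mu> (i + 1))}"

text \<open>
  The coefficient \<open>hl_phi\<close> in a form that allows recursion on the rows: \<open>k\<close> is the number of
  rows above \<open>lam\<close> that are equal to its first row, and the factor of the first row is kept
  only if \<open>ok\<close> holds.
\<close>

definition gen_phi :: "'a::field \<Rightarrow> nat \<Rightarrow> bool \<Rightarrow> nat list \<Rightarrow> nat list \<Rightarrow> 'a" where
  "gen_phi t k ok lam \<mu> = (\<Prod>i\<in>{i \<in> strip_ends lam \<mu>. i = hd lam \<longrightarrow> ok}.
     1 - t ^ (count_list lam i + (if i = hd lam then k else 0)))"

section \<open>Columns of a horizontal strip\<close>

lemma conj_part_Nil: "conj_part [] i = 0"
  by (simp add: conj_part_def)

lemma conj_part_Cons: "conj_part (a # l) i = (if i \<le> a then 1 else 0) + conj_part l i"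
proof -
  have "conj_part l i = length (filter (\<lambda>p. i \<le> p) l)" for l
    by (simp only: conj_part_def length_filter_conv_card)
  then show ?thesis by simp
qed

lemma conj_part_eq_0: "\<forall>p\<in>set l. p < i \<Longrightarrow> conj_part l i = 0"
  by (induction l) (auto simp: conj_part_Nil conj_part_Cons)

lemma length_strip_inner: "\<mu> \<in> strip_inner lam \<Longrightarrow> length \<mu> = length lam"
  by (induction lam arbitrary: \<mu>) auto

lemma finite_strip_inner: "finite (strip_inner lam)"
  by (induction lam) auto

lemma strip_inner_le_hd:
  "sorted_wrt (\<ge>) lam \<Longrightarrow> \<mu> \<in> strip_inner lam \<Longrightarrow> p \<in> set \<mu> \<Longrightarrow> p \<le> hd lam"
proof (induction lam arbitrary: \<mu>)
  case (Cons a l)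
  from Cons.prems(2) obtain m \<nu> where \<mu>: "\<mu> = m # \<nu>" "\<nu> \<in> strip_inner l" "m \<le> a" by auto
  show ?case
  proof (cases "p = m")
    case False
    then have p: "p \<in> set \<nu>" using Cons.prems(3) \<mu>(1) by simp
    then have "l \<noteq> []" using \<mu>(2) by auto
    then have "hd l \<le> a" using Cons.prems(1) by simp
    moreover have "p \<le> hd l" using Cons.IH[OF _ \<mu>(2) p] Cons.prems(1) by simp
    ultimately show ?thesis by simp
  qed (simp add: \<mu>(3))
qed simp

lemma sorted_le_hd: "sorted_wrt (\<ge>) lam \<Longrightarrow> p \<in> set lam \<Longrightarrow> p \<le> hd (lam :: nat list)"
  by (cases lam) auto

lemma conj_part_strip_0:
  assumes "sorted_wrt (\<ge>) lam" "\<mu> \<in> strip_inner lam" "lam \<noteq> [] \<Longrightarrow> hd lam < i"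
  shows "conj_part lam i = 0" "conj_part \<mu> i = 0"
proof -
  have "lam = [] \<Longrightarrow> \<mu> = []" using assms(2) by simp
  then have "\<forall>p\<in>set lam. p < i" "\<forall>p\<in>set \<mu>. p < i"
    using strip_inner_le_hd[OF assms(1,2)] sorted_le_hd[OF assms(1)] assms(3)
    by (cases "lam = []"; fastforce)+
  then show "conj_part lam i = 0" "conj_part \<mu> i = 0"
    by (simp_all add: conj_part_eq_0)
qed

text \<open>A column met by the first row of the strip lies to the right of \<open>m\<close>, hence
  of \<open>hd l\<close>, so no lower row reaches it.\<close>

lemma conj_part_strip_le:
  assumes "sorted_wrt (\<ge>) lam" "\<mu> \<in> strip_inner lam"
  shows "conj_part lam i \<le> conj_part \<mu> i + 1"
  using assms
proof (induction lam arbitrary: \<mu>)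
  case (Cons a l)
  from Cons.prems obtain m \<nu> where \<mu>: "\<mu> = m # \<nu>" "\<nu> \<in> strip_inner l" "m \<le> a"
    "l \<noteq> [] \<Longrightarrow> hd l \<le> m" by (auto split: if_splits)
  show ?case
  proof (cases "m < i \<and> i \<le> a")
    case True
    have "conj_part l i = 0"
      by (rule conj_part_strip_0(1)[OF _ \<mu>(2)]) (use Cons.prems \<mu>(4) True in auto)
    then show ?thesis by (simp add: \<mu>(1) conj_part_Cons)
  next
    case False
    then show ?thesis using Cons.IH[OF _ \<mu>(2)] Cons.prems \<mu>(3) by (auto simp: \<mu>(1) conj_part_Cons)
  qed
qed (simp add: conj_part_Nil)

lemma strip_ends_le_hd:
  assumes "sorted_wrt (\<ge>) lam" "\<mu> \<in> strip_inner lam" "i \<in> strip_ends lam \<mu>"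
  shows "lam \<noteq> [] \<and> i \<le> hd lam"
proof (rule ccontr)
  assume "\<not> ?thesis"
  then have *: "lam \<noteq> [] \<Longrightarrow> hd lam < i" "lam \<noteq> [] \<Longrightarrow> hd lam < i + 1" by auto
  show False
    using conj_part_strip_0[OF assms(1,2) *(1)] conj_part_strip_0[OF assms(1,2) *(2)] assms(3)
    by (simp add: strip_ends_def)
qed

text \<open>The new row has its boxes in the columns \<open>m + 1\<close> to \<open>a\<close>. If
  there are any, \<open>a\<close> becomes an end, and a run of lower boxes ending in column
  \<open>m\<close> is continued, so \<open>m\<close> ceases to be one; that its difference is at
  most 1 is \<open>le1\<close>.\<close>

lemma strip_ends_Cons:
  assumes sorted: "sorted_wrt (\<ge>) (a # l)" and \<mu>: "\<mu> \<in> strip_inner l"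
    and m: "1 \<le> m" "l \<noteq> [] \<Longrightarrow> hd l \<le> m" "m \<le> a"
  shows "strip_ends (a # l) (m # \<mu>) = (if m < a then insert a (strip_ends l \<mu> - {m}) else strip_ends l \<mu>)"
proof -
  have sorted': "sorted_wrt (\<ge>) l" using sorted by simp
  have zero: "conj_part l i = 0 \<and> conj_part \<mu> i = 0" if "m < i" for i
    using conj_part_strip_0[OF sorted' \<mu>, of i] that m(2) by (meson le_less_trans)
  have le1: "conj_part l i \<le> conj_part \<mu> i + 1" for i
    by (rule conj_part_strip_le[OF sorted' \<mu>])
  have "i \<in> strip_ends (a # l) (m # \<mu>) \<longleftrightarrow>
    i \<in> (if m < a then insert a (strip_ends l \<mu> - {m}) else strip_ends l \<mu>)" for i
  proof -
    consider "i < m" | "i = m" | "m < i" by linarith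
    then show ?thesis
    proof cases
      case 1
      then show ?thesis using m by (auto simp: strip_ends_def conj_part_Cons)
    next
      case 2
      then show ?thesis using m zero[of "Suc m"] le1[of m] by (auto simp: strip_ends_def conj_part_Cons)
    next
      case 3
      then show ?thesis using m zero[of i] zero[of "Suc i"] by (auto simp: strip_ends_def conj_part_Cons)
    qed
  qed
  then show ?thesis by blast
qed

section \<open>The coefficient, row by row\<close>

lemma finite_strip_ends: "finite (strip_ends lam \<mu>)"
  using finite_hl_phi_index[of lam \<mu>] by (simp add: strip_ends_def)

lemma gen_phi_Nil: "gen_phi t k ok [] [] = 1"
  by (auto simp: gen_phi_def strip_ends_def conj_part_Nil intro: prod.neutral)

text \<open>Between two equal rows \<open>\<mu>\<close> has no freedom: the top row has no box and
  only adds to the multiplicity of \<open>a\<close>, which \<open>Suc k\<close> records.\<close>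

lemma gen_phi_Cons_eq:
  assumes "sorted_wrt (\<ge>) (a # a # l)" "\<mu> \<in> strip_inner (a # l)" "1 \<le> a"
  shows "gen_phi t k ok (a # a # l) (a # \<mu>) = gen_phi t (Suc k) ok (a # l) \<mu>"
proof -
  have "strip_ends (a # a # l) (a # \<mu>) = strip_ends (a # l) \<mu>"
    by (subst strip_ends_Cons) (use assms in auto)
  then show ?thesis unfolding gen_phi_def by (intro prod.cong) auto
qed

text \<open>If \<open>m = hd l\<close>, a run ending in column \<open>hd l\<close> goes on in the
  row above and its factor is lost; if \<open>hd l < m\<close>, there is a gap and the factor stays.
  This is the flag passed to \<open>l\<close>. For \<open>l = []\<close> the value of
  \<open>hd l\<close> does not matter, since there are no ends.\<close>

lemma gen_phi_Cons_less:
  assumes sorted: "sorted_wrt (\<ge>) (a # l)" and \<mu>: "\<mu> \<in> strip_inner l"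
    and m: "1 \<le> m" "l \<noteq> [] \<Longrightarrow> hd l \<le> m" "m \<le> a" and less: "l \<noteq> [] \<Longrightarrow> hd l < a"
  shows "gen_phi t k ok (a # l) (m # \<mu>) =
    (if m < a \<and> ok then 1 - t ^ Suc k else 1) * gen_phi t 0 (hd l < m) l \<mu>"
proof -
  have sorted': "sorted_wrt (\<ge>) l" using sorted by simp
  have ends: "i < a \<and> l \<noteq> [] \<and> i \<le> hd l" if "i \<in> strip_ends l \<mu>" for i
    using strip_ends_le_hd[OF sorted' \<mu> that] less by auto
  have a: "a \<notin> set l" using sorted_le_hd[OF sorted', of a] less by (cases l) auto
  define J where "J = {i \<in> strip_ends l \<mu>. i = hd l \<longrightarrow> hd l < m}"
  have J: "finite J" "a \<notin> J" "\<And>i. i \<in> J \<Longrightarrow> i \<noteq> a"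
    using ends finite_strip_ends[of l \<mu>] by (auto simp: J_def)
  have "{i \<in> strip_ends (a # l) (m # \<mu>). i = hd (a # l) \<longrightarrow> ok} =
      (if m < a \<and> ok then insert a J else J)"
    (is "?L = ?R")
  proof (intro set_eqI)
    fix i
    show "i \<in> ?L \<longleftrightarrow> i \<in> ?R"
    proof (cases "i \<in> strip_ends l \<mu>")
      case True
      then have "i < a" "i \<le> hd l" "hd l \<le> m" "hd l < a" using ends[OF True] m(2) less by auto
      with True show ?thesis using m(3) by (auto simp: strip_ends_Cons[OF sorted \<mu> m] J_def)
    next
      case False
      then show ?thesis by (auto simp: strip_ends_Cons[OF sorted \<mu> m] J_def)
    qed
  qed
  moreover have "(\<Prod>i\<in>J. 1 - t ^ (count_list (a # l) i + (if i = hd (a # l) then k else 0))) = gen_phi t 0 (hd l < m) l \<mu>"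
    unfolding gen_phi_def J_def[symmetric] using J(3) by (intro prod.cong) auto
  ultimately show ?thesis
    using J(1,2) a unfolding gen_phi_def[of t k] by simp
qed

text \<open>With \<open>k = 0\<close> and \<open>ok = True\<close> this is the inner sum of the
  theorem, completed by \<open>\<mu> = lam\<close>, with monomials in place of the Hall-Littlewood
  polynomials.\<close>

definition strip_sum :: "'a::field \<Rightarrow> 'a \<Rightarrow> nat \<Rightarrow> bool \<Rightarrow> nat list \<Rightarrow> 'a list \<Rightarrow> 'a" where
  "strip_sum t x k ok lam ys = (\<Sum>\<mu>\<in>strip_inner lam.
     gen_phi t k ok lam \<mu> * x ^ sum_list (map2 (-) lam \<mu>) * monom_eval \<mu> ys)"

lemma strip_sum_Nil: "strip_sum t x k ok [] ys = 1"
  by (simp add: strip_sum_def gen_phi_Nil)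

lemma strip_sum_Cons:
  "strip_sum t x k ok (a # l) ys = (\<Sum>m\<in>{(if l = [] then 1 else hd l)..a}. \<Sum>\<mu>\<in>strip_inner l.
     gen_phi t k ok (a # l) (m # \<mu>) * x ^ (a - m) * hd ys ^ m *
       (x ^ sum_list (map2 (-) l \<mu>) * monom_eval \<mu> (tl ys)))"
proof -
  have pow: "x ^ sum_list (map2 (-) (a # l) (m # \<mu>)) = x ^ (a - m) * x ^ sum_list (map2 (-) l \<mu>)"
    for m \<mu> by (simp only: zip_Cons_Cons list.map sum_list.Cons case_prod_conv power_add)
  have "strip_sum t x k ok (a # l) ys = (\<Sum>m\<in>{(if l = [] then 1 else hd l)..a}. \<Sum>\<mu>\<in>(#) m ` strip_inner l.
     gen_phi t k ok (a # l) \<mu> * x ^ sum_list (map2 (-) (a # l) \<mu>) * monom_eval \<mu> ys)"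
    unfolding strip_sum_def strip_inner.simps
    by (rule sum.UNION_disjoint) (auto simp: finite_strip_inner)
  also have "\<dots> = (\<Sum>m\<in>{(if l = [] then 1 else hd l)..a}. \<Sum>\<mu>\<in>strip_inner l.
     gen_phi t k ok (a # l) (m # \<mu>) * x ^ (a - m) * hd ys ^ m *
       (x ^ sum_list (map2 (-) l \<mu>) * monom_eval \<mu> (tl ys)))"
    by (rule sum.cong[OF refl], subst sum.reindex) (simp, simp only: comp_def pow monom_eval.simps list.sel mult_ac)
  finally show ?thesis .
qed

lemma strip_sum_Cons_eq:
  assumes "sorted_wrt (\<ge>) (a # a # l)" "1 \<le> a"
  shows "strip_sum t x k ok (a # a # l) ys = hd ys ^ a * strip_sum t x (Suc k) ok (a # l) (tl ys)"
  unfolding strip_sum_Cons[of t x k ok a "a # l"]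
  using assms by (simp add: gen_phi_Cons_eq strip_sum_def sum_distrib_left ac_simps del: strip_inner.simps)

lemma strip_sum_Cons_less:
  assumes sorted: "sorted_wrt (\<ge>) (a # l)" and a: "1 \<le> a" and less: "l \<noteq> [] \<Longrightarrow> 1 \<le> hd l \<and> hd l < a"
  shows "strip_sum t x k ok (a # l) ys = (\<Sum>m\<in>{(if l = [] then 1 else hd l)..a}.
    (if m < a \<and> ok then 1 - t ^ Suc k else 1) * x ^ (a - m) * hd ys ^ m *
    strip_sum t x 0 (hd l < m) l (tl ys))"
  unfolding strip_sum_Cons
proof (intro sum.cong refl)
  fix m assume m: "m \<in> {(if l = [] then 1 else hd l)..a}"
  have "gen_phi t k ok (a # l) (m # \<mu>) = (if m < a \<and> ok then 1 - t ^ Suc k else 1) * gen_phi t 0 (hd l < m) l \<mu>"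
    if "\<mu> \<in> strip_inner l" for \<mu>
    using m less by (intro gen_phi_Cons_less sorted that) (auto split: if_splits)
  then show "(\<Sum>\<mu>\<in>strip_inner l. gen_phi t k ok (a # l) (m # \<mu>) * x ^ (a - m) * hd ys ^ m *
       (x ^ sum_list (map2 (-) l \<mu>) * monom_eval \<mu> (tl ys))) =
     (if m < a \<and> ok then 1 - t ^ Suc k else 1) * x ^ (a - m) * hd ys ^ m *
     strip_sum t x 0 (hd l < m) l (tl ys)"
    by (simp add: strip_sum_def sum_distrib_left ac_simps)
qed

section \<open>Summation over the first row of the inner partition\<close>

lemma sum_atLeastAtMost_split:
  fixes f :: "nat \<Rightarrow> 'b::comm_monoid_add"
  assumes "b < a"
  shows "(\<Sum>m\<in>{b..a}. f m) = f a + ((\<Sum>m\<in>{b<..<a}. f m) + f b)"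
proof -
  have "{b..a} = insert a (insert b {b<..<a})" using assms by auto
  then show ?thesis using assms by (simp add: add.commute)
qed

text \<open>The extreme exponents are left out because they carry other weights in
  \<open>strip_sum_Cons_less_True\<close>. The form \<open>Suc (b + n)\<close> of the upper end
  allows induction on the number \<open>n\<close> of summands.\<close>

lemma geometric_middle_sum:
  fixes x y :: "'a::field"
  assumes "y \<noteq> x"
  shows "(\<Sum>m\<in>{b<..<Suc (b + n)}. x ^ (Suc (b + n) - m) * y ^ m) =
    (x * y ^ Suc (b + n) - x ^ Suc n * y ^ Suc b) / (y - x)"
proof -
  have "(y - x) * (\<Sum>m\<in>{b<..<Suc (b + n)}. x ^ (Suc (b + n) - m) * y ^ m) =
      x * y ^ Suc (b + n) - x ^ Suc n * y ^ Suc b"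
  proof (induction n)
    case (Suc n)
    have "{b<..<Suc (b + Suc n)} = insert (Suc (b + n)) {b<..<Suc (b + n)}" by auto
    then have "(\<Sum>m\<in>{b<..<Suc (b + Suc n)}. x ^ (Suc (b + Suc n) - m) * y ^ m) =
        x * y ^ Suc (b + n) + (\<Sum>m\<in>{b<..<Suc (b + n)}. x ^ (Suc (Suc (b + n)) - m) * y ^ m)"
      by simp
    also have "(\<Sum>m\<in>{b<..<Suc (b + n)}. x ^ (Suc (Suc (b + n)) - m) * y ^ m) =
        x * (\<Sum>m\<in>{b<..<Suc (b + n)}. x ^ (Suc (b + n) - m) * y ^ m)"
      unfolding sum_distrib_left
    proof (rule sum.cong[OF refl])
      fix m assume "m \<in> {b<..<Suc (b + n)}"
      then have "Suc (Suc (b + n)) - m = Suc (Suc (b + n) - m)" by auto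
      then show "x ^ (Suc (Suc (b + n)) - m) * y ^ m = x * (x ^ (Suc (b + n) - m) * y ^ m)" by simp
    qed
    finally have "(y - x) * (\<Sum>m\<in>{b<..<Suc (b + Suc n)}. x ^ (Suc (b + Suc n) - m) * y ^ m) =
       (y - x) * (x * y ^ Suc (b + n)) + x * (x * y ^ Suc (b + n) - x ^ Suc n * y ^ Suc b)"
      by (simp only: distrib_left mult.left_commute[of "y - x" x] Suc.IH)
    then show ?case by (simp add: algebra_simps)
  next
    case 0
    have "{b<..<Suc (b + 0)} = {}" by auto
    then show ?case by simp
  qed
  then show ?thesis using assms by (simp add: field_simps)
qed

lemma strip_sum_Cons_less_True:
  assumes "sorted_wrt (\<ge>) (a # b # l)" "1 \<le> b" "b < a"
  shows "strip_sum t x k True (a # b # l) ys =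
    (hd ys ^ a + (1 - t ^ Suc k) * (\<Sum>m\<in>{b<..<a}. x ^ (a - m) * hd ys ^ m)) *
      strip_sum t x 0 True (b # l) (tl ys)
    + (1 - t ^ Suc k) * x ^ (a - b) * hd ys ^ b * strip_sum t x 0 False (b # l) (tl ys)"
proof -
  have "strip_sum t x k True (a # b # l) ys = (\<Sum>m\<in>{b..a}.
    (if m < a then 1 - t ^ Suc k else 1) * x ^ (a - m) * hd ys ^ m *
    strip_sum t x 0 (b < m) (b # l) (tl ys))"
    using assms by (subst strip_sum_Cons_less) auto
  also have "\<dots> = hd ys ^ a * strip_sum t x 0 True (b # l) (tl ys) +
    ((\<Sum>m\<in>{b<..<a}. (1 - t ^ Suc k) * (x ^ (a - m) * hd ys ^ m) * strip_sum t x 0 True (b # l) (tl ys)) +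
    (1 - t ^ Suc k) * x ^ (a - b) * hd ys ^ b * strip_sum t x 0 False (b # l) (tl ys))"
    unfolding sum_atLeastAtMost_split[OF assms(3)] using assms(3)
    by (intro arg_cong2[where f = "(+)"] sum.cong refl) (simp_all add: mult.assoc)
  finally show ?thesis
    by (simp only: sum_distrib_left[symmetric] sum_distrib_right[symmetric] distrib_right add.assoc)
qed

lemma strip_sum_Cons_less_False:
  assumes "sorted_wrt (\<ge>) (a # l)" "1 \<le> a" "l \<noteq> [] \<Longrightarrow> 1 \<le> hd l \<and> hd l < a"
  shows "strip_sum t x k False (a # l) ys = strip_sum t x 0 False (a # l) ys"
  using assms by (simp add: strip_sum_Cons_less)

lemma strip_sum_single:
  assumes "1 \<le> a"
  shows "strip_sum t x k True [a] ys =
    hd ys ^ a + (1 - t ^ Suc k) * (\<Sum>m\<in>{0<..<a}. x ^ (a - m) * hd ys ^ m)"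
    "strip_sum t x k False [a] ys =
    hd ys ^ a + (\<Sum>m\<in>{0<..<a}. x ^ (a - m) * hd ys ^ m)"
proof -
  have "{1..a} = insert a {0<..<a}" using assms by auto
  then have "strip_sum t x k ok [a] ys =
      hd ys ^ a + (\<Sum>m\<in>{0<..<a}. (if ok then 1 - t ^ Suc k else 1) * (x ^ (a - m) * hd ys ^ m))" for ok
    using assms by (subst strip_sum_Cons_less)
      (auto simp: strip_sum_Nil mult.assoc simp del: power_Suc intro!: sum.cong)
  then show "strip_sum t x k True [a] ys =
    hd ys ^ a + (1 - t ^ Suc k) * (\<Sum>m\<in>{0<..<a}. x ^ (a - m) * hd ys ^ m)"
    "strip_sum t x k False [a] ys =
    hd ys ^ a + (\<Sum>m\<in>{0<..<a}. x ^ (a - m) * hd ys ^ m)"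
    by (simp_all only: if_True if_False mult_1_left sum_distrib_left)
qed

text \<open>Only the factor \<open>1 - t ^ (r + k)\<close> of the first row depends on
  \<open>k\<close>, where \<open>r\<close> is the multiplicity of that row. With \<open>ok\<close>
  the sum is therefore \<open>A + (1 - t ^ (r + k)) * B\<close>, and without it
  \<open>A + B\<close>, for \<open>A\<close> and \<open>B\<close> independent of
  \<open>k\<close>.\<close>

lemma strip_sum_linear:
  assumes "sorted_wrt (\<ge>) lam" "0 \<notin> set lam" "lam \<noteq> []"
  shows "strip_sum t x k False lam ys = strip_sum t x 0 False lam ys"
    and "strip_sum t x (Suc k) True lam ys - t * strip_sum t x k True lam ys =
      (1 - t) * strip_sum t x 0 False lam ys"
proof -
  have "strip_sum t x k False lam ys = strip_sum t x 0 False lam ys \<and>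
    strip_sum t x (Suc k) True lam ys - t * strip_sum t x k True lam ys =
      (1 - t) * strip_sum t x 0 False lam ys"
    using assms
  proof (induction lam arbitrary: k ys)
    case (Cons a l)
    have a: "1 \<le> a" using Cons.prems by auto
    consider "l = []" | l' where "l = a # l'" | b l' where "l = b # l'" "b < a"
      using Cons.prems(1) by (cases l) force+
    then show ?case
    proof cases
      case 1
      then show ?thesis using a by (simp add: strip_sum_single algebra_simps)
    next
      case 2
      have IH: "strip_sum t x k False l ys = strip_sum t x 0 False l ys"
        "strip_sum t x (Suc k) True l ys - t * strip_sum t x k True l ys =
          (1 - t) * strip_sum t x 0 False l ys" for k ys
        using Cons 2 by auto
      have eq: "strip_sum t x k ok (a # l) ys = hd ys ^ a * strip_sum t x (Suc k) ok l (tl ys)" for k ok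
        unfolding 2 using Cons.prems a 2 by (intro strip_sum_Cons_eq) auto
      have "strip_sum t x (Suc k) True (a # l) ys - t * strip_sum t x k True (a # l) ys =
          hd ys ^ a * (strip_sum t x (Suc (Suc k)) True l (tl ys) - t * strip_sum t x (Suc k) True l (tl ys))"
        unfolding eq by (simp only: right_diff_distrib mult.left_commute)
      also have "\<dots> = (1 - t) * strip_sum t x 0 False (a # l) ys"
        unfolding IH(2) eq IH(1)[of "Suc _"] by (simp only: mult.left_commute)
      finally show ?thesis unfolding eq IH(1)[of "Suc _"] by simp
    next
      case 3
      have b: "1 \<le> b" using Cons.prems 3 by (cases b) auto
      have "strip_sum t x k False (a # l) ys = strip_sum t x 0 False (a # l) ys"
        using Cons.prems a b 3 by (intro strip_sum_Cons_less_False) auto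
      moreover have F: "strip_sum t x 0 False (a # l) ys =
          (hd ys ^ a + (\<Sum>m\<in>{b<..<a}. x ^ (a - m) * hd ys ^ m)) * strip_sum t x 0 True l (tl ys)
          + x ^ (a - b) * hd ys ^ b * strip_sum t x 0 False l (tl ys)"
      proof -
        have "strip_sum t x 0 False (a # l) ys = (\<Sum>m\<in>{b..a}. x ^ (a - m) * hd ys ^ m *
            strip_sum t x 0 (b < m) l (tl ys))"
          using Cons.prems a b 3 by (subst strip_sum_Cons_less) auto
        also have "\<dots> = hd ys ^ a * strip_sum t x 0 True l (tl ys) +
          ((\<Sum>m\<in>{b<..<a}. x ^ (a - m) * hd ys ^ m * strip_sum t x 0 True l (tl ys)) +
          x ^ (a - b) * hd ys ^ b * strip_sum t x 0 False l (tl ys))"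
          unfolding sum_atLeastAtMost_split[OF 3(2)] using 3(2)
          by (intro arg_cong2[where f = "(+)"] sum.cong refl) (simp_all add: mult.assoc)
        finally show ?thesis
          by (simp only: sum_distrib_right[symmetric] distrib_right add.assoc)
      qed
      moreover have T: "strip_sum t x k True (a # l) ys =
        (hd ys ^ a + (1 - t ^ Suc k) * (\<Sum>m\<in>{b<..<a}. x ^ (a - m) * hd ys ^ m)) *
          strip_sum t x 0 True l (tl ys)
        + (1 - t ^ Suc k) * x ^ (a - b) * hd ys ^ b * strip_sum t x 0 False l (tl ys)" for k
        unfolding 3(1) using Cons.prems b 3 by (intro strip_sum_Cons_less_True) auto
      moreover have "strip_sum t x (Suc k) True (a # l) ys - t * strip_sum t x k True (a # l) ys =
          (1 - t) * strip_sum t x 0 False (a # l) ys"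
        unfolding T F by (simp add: algebra_simps)
      ultimately show ?thesis by simp
    qed
  qed simp
  then show "strip_sum t x k False lam ys = strip_sum t x 0 False lam ys"
    "strip_sum t x (Suc k) True lam ys - t * strip_sum t x k True lam ys =
      (1 - t) * strip_sum t x 0 False lam ys" by auto
qed

text \<open>As a function of \<open>k\<close> the sum is a combination of 1 and
  \<open>t ^ k\<close>, so consecutive values satisfy the recurrence with coefficients
  \<open>1 + t\<close> and \<open>- t\<close>. The subtracted term is \<open>t\<close> times the
  formal value at \<open>k = -1\<close>.\<close>

lemma strip_sum_second_row:
  assumes "sorted_wrt (\<ge>) (b # l)" "0 \<notin> set (b # l)"
  shows "strip_sum t x 1 True (b # l) ys =
    (1 + t) * strip_sum t x 0 True (b # l) ys - t * hd ys ^ b * strip_sum t x 0 True l (tl ys)"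
proof -
  have b: "1 \<le> b" using assms by auto
  consider "l = []" | l' where "l = b # l'" | c l' where "l = c # l'" "c < b"
    using assms(1) by (cases l) force+
  then show ?thesis
  proof cases
    case 1
    then show ?thesis using b by (simp add: strip_sum_single strip_sum_Nil algebra_simps)
  next
    case 2
    have eq: "strip_sum t x k True (b # l) ys = hd ys ^ b * strip_sum t x (Suc k) True l (tl ys)" for k
      unfolding 2 using assms b 2 by (intro strip_sum_Cons_eq) auto
    have lin: "strip_sum t x (Suc k) True l (tl ys) - t * strip_sum t x k True l (tl ys) =
      (1 - t) * strip_sum t x 0 False l (tl ys)" for k
      using assms 2 by (intro strip_sum_linear) auto
    have "strip_sum t x (Suc (Suc 0)) True l (tl ys) - t * strip_sum t x (Suc 0) True l (tl ys) =
        strip_sum t x (Suc 0) True l (tl ys) - t * strip_sum t x 0 True l (tl ys)"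
      by (simp only: lin)
    then have two: "strip_sum t x (Suc (Suc 0)) True l (tl ys) =
        (1 + t) * strip_sum t x (Suc 0) True l (tl ys) - t * strip_sum t x 0 True l (tl ys)"
      by (simp add: algebra_simps)
    show ?thesis unfolding One_nat_def eq two by (simp add: algebra_simps)
  next
    case 3
    have c: "1 \<le> c" using assms 3 by (cases c) auto
    have T: "strip_sum t x k True (b # l) ys =
        (hd ys ^ b + (1 - t ^ Suc k) * (\<Sum>m\<in>{c<..<b}. x ^ (b - m) * hd ys ^ m)) *
          strip_sum t x 0 True l (tl ys)
        + (1 - t ^ Suc k) * x ^ (b - c) * hd ys ^ c * strip_sum t x 0 False l (tl ys)" for k
      unfolding 3(1) using assms c 3 by (intro strip_sum_Cons_less_True) auto
    show ?thesis unfolding T by (simp add: algebra_simps)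
  qed
qed

text \<open>The sum with \<open>ok = False\<close> that arises from \<open>m = b\<close> is
  rewritten in sums with \<open>k = 0\<close> and \<open>ok = True\<close>; this is the origin of
  the subtracted term. For \<open>a = b\<close> the bracket collapses to
  \<open>y ^ a * (1 + t)\<close>, so one formula also covers repeated rows.\<close>

lemma strip_sum_recursion:
  assumes "sorted_wrt (\<ge>) (a # b # l)" "0 \<notin> set (a # b # l)" and xy: "y \<noteq> x"
  shows "strip_sum t x 0 True (a # b # l) (y # ys) =
    (y ^ a * ((y - t * x) / (y - x)) + x ^ (a - b) * y ^ b * ((x - t * y) / (x - y))) *
      strip_sum t x 0 True (b # l) ys
    - t * x ^ (a - b) * y ^ b * hd ys ^ b * strip_sum t x 0 True l (tl ys)"
proof -
  have b: "1 \<le> b" using assms by (cases b) auto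
  have sub: "sorted_wrt (\<ge>) (b # l)" "0 \<notin> set (b # l)" using assms by auto
  have flip: "(x - t * y) / (x - y) = - ((x - t * y) / (y - x))"
    by (metis minus_diff_eq minus_divide_right)
  consider "a = b" | "b < a" using assms by fastforce
  then show ?thesis
  proof cases
    case 1
    have "(y - t * x) / (y - x) + (x - t * y) / (x - y) = 1 + t"
    proof -
      have "(y - t * x) / (y - x) + (x - t * y) / (x - y) = (y - t * x - (x - t * y)) / (y - x)"
        unfolding flip by (simp add: diff_divide_distrib)
      also have "y - t * x - (x - t * y) = (1 + t) * (y - x)" by (simp add: algebra_simps)
      finally show ?thesis using xy by simp
    qed
    then have br: "y ^ a * ((y - t * x) / (y - x)) + x ^ (a - b) * y ^ b * ((x - t * y) / (x - y)) = y ^ a * (1 + t)"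
      unfolding 1 diff_self_eq_0 power_0 mult_1_left distrib_left[symmetric] by (rule arg_cong)
    have "strip_sum t x 0 True (a # b # l) (y # ys) = y ^ a * strip_sum t x 1 True (b # l) ys"
      using strip_sum_Cons_eq[of a l t x 0 True "y # ys"] assms 1 b by simp
    then show ?thesis unfolding br strip_sum_second_row[OF sub] using 1 by (simp add: algebra_simps)
  next
    case 2
    obtain n where n: "a = Suc (b + n)" using 2 less_iff_Suc_add by auto
    have diff: "a - b = Suc n" using n by simp
    have mid: "(\<Sum>m\<in>{b<..<a}. x ^ (a - m) * y ^ m) = (x * y ^ a - x ^ (a - b) * y ^ Suc b) / (y - x)"
      unfolding diff unfolding n by (rule geometric_middle_sum[OF xy])
    \<comment> \<open>Here \<open>p\<close> and \<open>q\<close> are the extreme terms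
      \<open>m = a\<close> and \<open>m = b\<close>, and the quotient is the geometric sum between
      them. The weight \<open>1 - t\<close> of \<open>q\<close> is absorbed by \<open>F\<close>
      below.\<close>
    have "p + (1 - t) * ((x * p - y * q) / (y - x)) + q =
        p * ((y - t * x) / (y - x)) + q * ((x - t * y) / (x - y))" for p q
    proof -
      have "p + (1 - t) * ((x * p - y * q) / (y - x)) + q =
          (p * (y - x) + (1 - t) * (x * p - y * q) + q * (y - x)) / (y - x)"
        using xy by (simp add: add_divide_distrib)
      also have "p * (y - x) + (1 - t) * (x * p - y * q) + q * (y - x) =
          p * (y - t * x) - q * (x - t * y)" by (simp add: algebra_simps)
      also have "(p * (y - t * x) - q * (x - t * y)) / (y - x) =
          p * (y - t * x) / (y - x) - q * (x - t * y) / (y - x)" by (rule diff_divide_distrib)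
      finally show ?thesis unfolding flip
        by (simp only: times_divide_eq_right mult_minus_right diff_conv_add_uminus)
    qed
    from this[of "y ^ a" "x ^ (a - b) * y ^ b"]
    have br: "y ^ a + (1 - t) * ((x * y ^ a - x ^ (a - b) * y ^ Suc b) / (y - x)) + x ^ (a - b) * y ^ b
      = y ^ a * ((y - t * x) / (y - x)) + x ^ (a - b) * y ^ b * ((x - t * y) / (x - y))"
      by (simp only: power_Suc ac_simps)
    have F: "(1 - t) * strip_sum t x 0 False (b # l) ys =
        strip_sum t x 0 True (b # l) ys - t * hd ys ^ b * strip_sum t x 0 True l (tl ys)"
    proof -
      have "b # l \<noteq> []" by simp
      note strip_sum_linear(2)[OF sub this, of t x 0 ys, symmetric, folded One_nat_def]
      also note strip_sum_second_row[OF sub]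
      finally show ?thesis by (simp add: algebra_simps)
    qed
    have "strip_sum t x 0 True (a # b # l) (y # ys) =
      (y ^ a + (1 - t) * (\<Sum>m\<in>{b<..<a}. x ^ (a - m) * y ^ m)) * strip_sum t x 0 True (b # l) ys
      + x ^ (a - b) * y ^ b * ((1 - t) * strip_sum t x 0 False (b # l) ys)"
      using strip_sum_Cons_less_True[OF assms(1) b 2, of t x 0 "y # ys"] by (simp add: ac_simps)
    then show ?thesis unfolding F mid br[symmetric] by (simp only: algebra_simps)
  qed
qed

section \<open>Reduction of the inner sum modulo symmetrisation\<close>

text \<open>
  The words that survive symmetrisation. In \<open>tail_word\<close> the final factor stands for the row below
  which \<open>\<mu>\<close> may not reach 0, so that its geometric sum starts at exponent 1.
\<close>

primrec tail_word :: "'a::field \<Rightarrow> 'a \<Rightarrow> nat list \<Rightarrow> 'a list \<Rightarrow> 'a" where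
  "tail_word t x [] ys = (1 - t) * hd ys / (x - hd ys)"
| "tail_word t x (b # l) ys = hd ys ^ b * ((x - t * hd ys) / (x - hd ys)) * tail_word t x l (tl ys)"

text \<open>There is one word for each row at which the second kind may set in, and one without it.
  The powers of \<open>x\<close> telescope to \<open>x ^ a\<close>, and from there on each variable
  carries the exponent of the next row.\<close>

primrec word_sum :: "'a::field \<Rightarrow> 'a \<Rightarrow> nat list \<Rightarrow> 'a list \<Rightarrow> 'a" where
  "word_sum t x [] ys = 1"
| "word_sum t x (a # l) ys =
    hd ys ^ a * ((hd ys - t * x) / (hd ys - x)) * word_sum t x l (tl ys) + x ^ a * tail_word t x l ys"

text \<open>The factor \<open>(1 - t) * y / (x - y)\<close> is
  \<open>(x - t * y) / (x - y) - 1\<close>: the subtracted 1 removes the exponent 0, which the last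
  row may not reach.\<close>

lemma strip_sum_single_eq_word_sum:
  assumes "1 \<le> a" "y \<noteq> x"
  shows "strip_sum t x 0 True [a] [y] = word_sum t x [a] [y]"
proof -
  obtain n where n: "a = Suc (0 + n)" using assms(1) by (cases a) auto
  have mid: "(\<Sum>m\<in>{0<..<a}. x ^ (a - m) * y ^ m) = (x * y ^ a - x ^ a * y) / (y - x)"
    unfolding n using geometric_middle_sum[OF assms(2), of 0 n] by simp
  have flip: "(1 - t) * y / (x - y) = - ((1 - t) * y / (y - x))"
    by (metis minus_diff_eq minus_divide_right)
  have "p + (1 - t) * ((x * p - q * y) / (y - x)) =
      p * ((y - t * x) / (y - x)) + q * (- ((1 - t) * y / (y - x)))" for p q
  proof -
    have "p + (1 - t) * ((x * p - q * y) / (y - x)) =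
        (p * (y - x) + (1 - t) * (x * p - q * y)) / (y - x)"
      using assms(2) by (simp add: add_divide_distrib)
    also have "p * (y - x) + (1 - t) * (x * p - q * y) = p * (y - t * x) - q * ((1 - t) * y)"
      by (simp add: algebra_simps)
    also have "(p * (y - t * x) - q * ((1 - t) * y)) / (y - x) =
        p * (y - t * x) / (y - x) - q * ((1 - t) * y) / (y - x)" by (rule diff_divide_distrib)
    finally show ?thesis
      by (simp only: times_divide_eq_right mult_minus_right diff_conv_add_uminus)
  qed
  from this[of "y ^ a" "x ^ a"] show ?thesis
    by (simp only: strip_sum_single(1)[OF assms(1)] list.sel mid word_sum.simps tail_word.simps flip
        power_one_right One_nat_def[symmetric] mult_1_right)
qed

text \<open>
  After multiplication by \<open>(y - t z) / (y - z)\<close> the expression below is antisymmetric in \<open>y\<close>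
  and \<open>z\<close>. This is why symmetrisation kills every product in which the second
  summand of the first factor of \<open>strip_sum_recursion\<close> is followed by the first summand of the next one.
\<close>

lemma word_swap_antisymmetric:
  fixes t x y z :: "'a::field"
  assumes "x \<noteq> y" "x \<noteq> z" "y \<noteq> z"
  defines "g \<equiv> \<lambda>y z. (x - t * y) / (x - y) * ((z - t * x) / (z - x)) - t"
  shows "(y - t * z) / (y - z) * g y z + (z - t * y) / (z - y) * g z y = 0"
proof -
  have g: "g y z = x * (1 - t) * (z - t * y) / ((x - y) * (z - x))" if "x \<noteq> y" "x \<noteq> z" for y z
  proof -
    have "P / D - t = (P - t * D) / D" if "D \<noteq> 0" for P D
      using that by (simp add: diff_divide_distrib)
    from this[of "(x - y) * (z - x)" "(x - t * y) * (z - t * x)"]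
    have "g y z = ((x - t * y) * (z - t * x) - t * ((x - y) * (z - x))) / ((x - y) * (z - x))"
      using that by (simp add: g_def)
    also have "(x - t * y) * (z - t * x) - t * ((x - y) * (z - x)) = x * (1 - t) * (z - t * y)"
      by (simp add: algebra_simps)
    finally show ?thesis .
  qed
  have "(z - t * y) / (z - y) = - ((z - t * y) / (y - z))" "(x - z) * (y - x) = (x - y) * (z - x)"
    by (simp_all add: algebra_simps) (metis minus_diff_eq minus_divide_right)
  then show ?thesis
    by (simp add: g[OF assms(1,2)] g[OF assms(2,1)] mult_ac)
qed

text \<open>Once the induction hypothesis is inserted into \<open>strip_sum_recursion\<close>, the
  excess over the words for \<open>lam\<close> is the product of a second and a first kind in
  adjacent rows, reduced by \<open>t\<close>. This reduction is what makes it antisymmetric. The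
  recursion goes back two rows, hence induction on the length.\<close>

lemma symsum_strip_sum_eq_word_sum:
  assumes V: "finite V" "x \<notin> V" and two: "(2::'a::field) \<noteq> 0"
    and lam: "sorted_wrt (\<ge>) lam" "0 \<notin> set lam"
  shows "symsum t (length lam) V (strip_sum t x 0 True lam) = symsum t (length lam) V (word_sum t (x::'a) lam)"
  using V lam
proof (induction lam arbitrary: V rule: length_induct)
  case (1 lam)
  note V = \<open>finite V\<close> \<open>x \<notin> V\<close>
  have IH: "symsum t (length l) W (strip_sum t x 0 True l) = symsum t (length l) W (word_sum t x l)"
    if "length l < length lam" "W \<subseteq> V" "sorted_wrt (\<ge>) l" "0 \<notin> set l" for l W
    using 1 that by (meson finite_subset subsetD)
  consider "lam = []" | a where "lam = [a]" | a b l where "lam = a # b # l"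
    by (metis list.exhaust)
  then show ?case
  proof cases
    case 1
    then show ?thesis by (simp add: strip_sum_Nil)
  next
    case 2
    then have a: "1 \<le> a" using \<open>0 \<notin> set lam\<close> by auto
    show ?thesis
    proof (rule symsum_cong)
      fix ys :: "'a list" assume "length ys = length lam" "set ys \<subseteq> V"
      then obtain y where "ys = [y]" "y \<noteq> x" using 2 V by (cases ys) auto
      then show "strip_sum t x 0 True lam ys = word_sum t x lam ys"
        using strip_sum_single_eq_word_sum[OF a] 2 by simp
    qed
  next
    case (3 a b l)
    let ?k = "length l"
    let ?S = "\<lambda>y. (y - t * x) / (y - x)" and ?T = "\<lambda>y. (x - t * y) / (x - y)"
    let ?E = "strip_sum t x 0 True" and ?W = "word_sum t x" and ?U = "tail_word t x"
    have sub: "sorted_wrt (\<ge>) (b # l)" "0 \<notin> set (b # l)" "sorted_wrt (\<ge>) l" "0 \<notin> set l" "b \<le> a"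
      using \<open>sorted_wrt (\<ge>) lam\<close> \<open>0 \<notin> set lam\<close> 3 by auto
    have IH1: "symsum t (Suc ?k) W (?E (b # l)) = symsum t (Suc ?k) W (?W (b # l))" if "W \<subseteq> V" for W
      using IH[of "b # l" W] sub that 3 by simp
    have IH2: "symsum t ?k W (?E l) = symsum t ?k W (?W l)" if "W \<subseteq> V" for W
      using IH[of l W] sub that 3 by simp
    have "symsum t (Suc (Suc ?k)) V (?E lam) = symsum t (Suc (Suc ?k)) V
      (\<lambda>ys. (hd ys ^ a * ?S (hd ys) + x ^ (a - b) * hd ys ^ b * ?T (hd ys)) * ?E (b # l) (tl ys)
         - t * x ^ (a - b) * hd ys ^ b * hd (tl ys) ^ b * ?E l (tl (tl ys)))"
    proof (rule symsum_cong)
      fix ys :: "'a list" assume "length ys = Suc (Suc ?k)" "set ys \<subseteq> V"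
      then obtain y zs where ys: "ys = y # zs" "y \<noteq> x" using V by (cases ys) auto
      show "?E lam ys = (hd ys ^ a * ?S (hd ys) + x ^ (a - b) * hd ys ^ b * ?T (hd ys)) * ?E (b # l) (tl ys)
         - t * x ^ (a - b) * hd ys ^ b * hd (tl ys) ^ b * ?E l (tl (tl ys))"
        using strip_sum_recursion[of a b l y x t zs] \<open>sorted_wrt (\<ge>) lam\<close> \<open>0 \<notin> set lam\<close> ys
        unfolding 3 by simp
    qed
    also have "\<dots> = symsum t (Suc (Suc ?k)) V
      (\<lambda>ys. (hd ys ^ a * ?S (hd ys) + x ^ (a - b) * hd ys ^ b * ?T (hd ys)) * ?W (b # l) (tl ys)
         - t * x ^ (a - b) * hd ys ^ b * hd (tl ys) ^ b * ?W l (tl (tl ys)))"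
      unfolding symsum_diff
    proof (rule arg_cong2[where f = "(-)"])
      show "symsum t (Suc (Suc ?k)) V (\<lambda>ys. (hd ys ^ a * ?S (hd ys) + x ^ (a - b) * hd ys ^ b * ?T (hd ys)) * ?E (b # l) (tl ys))
       = symsum t (Suc (Suc ?k)) V (\<lambda>ys. (hd ys ^ a * ?S (hd ys) + x ^ (a - b) * hd ys ^ b * ?T (hd ys)) * ?W (b # l) (tl ys))"
        unfolding symsum.simps(2)[of t "Suc ?k"] list.sel symsum_cmult
        by (intro sum.cong refl arg_cong2[where f = "(*)"] IH1) auto
      show "symsum t (Suc (Suc ?k)) V (\<lambda>ys. t * x ^ (a - b) * hd ys ^ b * hd (tl ys) ^ b * ?E l (tl (tl ys)))
       = symsum t (Suc (Suc ?k)) V (\<lambda>ys. t * x ^ (a - b) * hd ys ^ b * hd (tl ys) ^ b * ?W l (tl (tl ys)))"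
        unfolding symsum.simps(2) list.sel symsum_cmult
        by (intro sum.cong refl arg_cong2[where f = "(*)"] IH2) auto
    qed
    also have "\<dots> = symsum t (Suc (Suc ?k)) V
      (\<lambda>ys. ?W lam ys + x ^ (a - b) * ((hd ys * hd (tl ys)) ^ b *
        (?T (hd ys) * ?S (hd (tl ys)) - t) * ?W l (tl (tl ys))))"
    proof (rule symsum_cong)
      fix ys :: "'a list"
      have pow: "x ^ a = x ^ (a - b) * x ^ b" using sub(5) by (simp add: power_add[symmetric])
      show "(hd ys ^ a * ?S (hd ys) + x ^ (a - b) * hd ys ^ b * ?T (hd ys)) * ?W (b # l) (tl ys)
         - t * x ^ (a - b) * hd ys ^ b * hd (tl ys) ^ b * ?W l (tl (tl ys)) =
        ?W lam ys + x ^ (a - b) * ((hd ys * hd (tl ys)) ^ b *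
        (?T (hd ys) * ?S (hd (tl ys)) - t) * ?W l (tl (tl ys)))"
        unfolding 3 word_sum.simps(2) tail_word.simps(2) pow power_mult_distrib
        by (simp only: ring_distribs) (simp only: algebra_simps)
    qed
    also have "\<dots> = symsum t (Suc (Suc ?k)) V (?W lam)"
    proof -
      have "symsum t (Suc (Suc ?k)) V (\<lambda>ys. (hd ys * hd (tl ys)) ^ b *
        (?T (hd ys) * ?S (hd (tl ys)) - t) * ?W l (tl (tl ys))) = 0"
      proof (rule symsum_swap_zero[OF V(1) two, where g = "\<lambda>y z. (y * z) ^ b * (?T y * ?S z - t)"])
        fix y z assume "y \<in> V" "z \<in> V" "y \<noteq> z"
        then have "(y - t * z) / (y - z) * (?T y * ?S z - t) + (z - t * y) / (z - y) * (?T z * ?S y - t) = 0"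
          using V by (intro word_swap_antisymmetric) auto
        then have "(y * z) ^ b * ((y - t * z) / (y - z) * (?T y * ?S z - t) + (z - t * y) / (z - y) * (?T z * ?S y - t)) = 0"
          by simp
        then show "(y - t * z) / (y - z) * ((y * z) ^ b * (?T y * ?S z - t)) +
            (z - t * y) / (z - y) * ((z * y) ^ b * (?T z * ?S y - t)) = 0"
          by (simp only: distrib_left mult.commute[of z y] mult.left_commute)
      qed
      then show ?thesis unfolding symsum_add symsum_cmult by simp
    qed
    finally show ?thesis using 3 by simp
  qed
qed

section \<open>Summation over the omitted variable\<close>

lemma tail_word_append:
  assumes "length l = length ys" "distinct ys"
  shows "tail_word t x l (ys @ [w]) = monom_eval l ys * cross t x (set ys) * ((1 - t) * w / (x - w))"
  using assms
proof (induction l arbitrary: ys)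
  case (Cons b l)
  then obtain y zs where "ys = y # zs" by (cases ys) auto
  with Cons show ?case by (simp add: cross_def)
qed (simp add: cross_def)

text \<open>The word without insertion leaves \<open>x\<close> among the variables outside
  \<open>ys\<close> and yields the sum of \<open>c w\<close>; the word in which \<open>x\<close> is
  inserted as an entry \<open>y\<close> yields the term of \<open>y\<close>. The weight
  \<open>c\<close> is arbitrary because in the application it is formed from all variables, while
  the induction removes variables from \<open>V\<close>.\<close>

lemma sum_symsum_word_sum:
  assumes V: "finite V" and res: "\<And>u v. u \<in> V \<Longrightarrow> v \<in> V \<Longrightarrow> u \<noteq> t * v"
  shows "(\<Sum>x\<in>V. c x * symsum t (length lam) (V - {x}) (word_sum t x lam)) =
    symsum t (length lam) V (\<lambda>ys. monom_eval lam ys * ((\<Sum>w\<in>V - set ys. c w) +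
      (\<Sum>y\<in>set ys. c y / cross t y (V - set ys) *
        (\<Sum>w\<in>V - set ys. (1 - t) * w / (y - w) * cross t w (V - set ys - {w})))))"
  using assms
proof (induction lam arbitrary: V)
  case (Cons a l)
  note V = Cons.prems(1) and res = Cons.prems(2)
  let ?k = "length l"
  let ?R = "\<lambda>V ys. \<Sum>y\<in>set ys. c y / cross t y (V - set ys) *
        (\<Sum>w\<in>V - set ys. (1 - t) * w / (y - w) * cross t w (V - set ys - {w}))"
  have "(\<Sum>x\<in>V. c x * symsum t (Suc ?k) (V - {x}) (\<lambda>ys. hd ys ^ a *
        ((hd ys - t * x) / (hd ys - x)) * word_sum t x l (tl ys))) =
     (\<Sum>x\<in>V. \<Sum>y\<in>V-{x}. c x * (cross t y (V - {x} - {y}) * (y ^ a * ((y - t * x) / (y - x)) *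
        symsum t ?k (V - {x} - {y}) (word_sum t x l))))"
    by (simp only: symsum.simps(2) list.sel symsum_cmult sum_distrib_left)
  also have "\<dots> = (\<Sum>y\<in>V. \<Sum>x\<in>V-{y}. c x * (cross t y (V - {x} - {y}) * (y ^ a * ((y - t * x) / (y - x)) *
        symsum t ?k (V - {x} - {y}) (word_sum t x l))))"
    by (rule sum_ordered_pairs_swap[OF V])
  also have "\<dots> = (\<Sum>y\<in>V. \<Sum>x\<in>V-{y}. cross t y (V - {y}) * (y ^ a *
        (c x * symsum t ?k (V - {y} - {x}) (word_sum t x l))))"
  proof (intro sum.cong refl)
    fix x y assume xy: "y \<in> V" "x \<in> V - {y}"
    have eq: "V - {x} - {y} = V - {y} - {x}" by auto
    \<comment> \<open>A factor of the first kind is what the omitted \<open>x\<close> would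
      contribute to \<open>cross\<close>, so \<open>y\<close> becomes an ordinary first entry over
      all of \<open>V\<close>.\<close>
    have "cross t y (V - {y}) = (y - t * x) / (y - x) * cross t y (V - {y} - {x})"
      by (rule cross_remove) (use xy V in auto)
    then show "c x * (cross t y (V - {x} - {y}) * (y ^ a * ((y - t * x) / (y - x)) *
        symsum t ?k (V - {x} - {y}) (word_sum t x l))) =
      cross t y (V - {y}) * (y ^ a * (c x * symsum t ?k (V - {y} - {x}) (word_sum t x l)))"
      unfolding eq by (simp only: mult_ac)
  qed
  also have "\<dots> = (\<Sum>y\<in>V. cross t y (V - {y}) * (y ^ a *
        (\<Sum>x\<in>V-{y}. c x * symsum t ?k (V - {y} - {x}) (word_sum t x l))))"
    by (simp only: sum_distrib_left)
  also have "\<dots> = (\<Sum>y\<in>V. cross t y (V - {y}) * (y ^ a *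
      symsum t ?k (V - {y}) (\<lambda>ys. monom_eval l ys * ((\<Sum>w\<in>V - {y} - set ys. c w) + ?R (V - {y}) ys))))"
    by (intro sum.cong refl arg_cong2[where f = "(*)"] Cons.IH) (use V res in auto)
  also have "\<dots> = symsum t (Suc ?k) V (\<lambda>zs. monom_eval (a # l) zs *
      ((\<Sum>w\<in>V - set zs. c w) + (\<Sum>y\<in>set (tl zs). c y / cross t y (V - set zs) *
        (\<Sum>w\<in>V - set zs. (1 - t) * w / (y - w) * cross t w (V - set zs - {w})))))"
  proof -
    have eq: "V - {y} - set ys = V - set (y # ys)" for y ys by auto
    show ?thesis by (simp only: eq symsum.simps(2) monom_eval.simps list.sel symsum_cmult mult.assoc)
  qed
  finally have A: "(\<Sum>x\<in>V. c x * symsum t (Suc ?k) (V - {x}) (\<lambda>ys. hd ys ^ a *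
        ((hd ys - t * x) / (hd ys - x)) * word_sum t x l (tl ys))) = \<dots>" .

  \<comment> \<open>Only second kinds: \<open>x\<close> takes the first row with exponent
    \<open>a\<close>, the other entries move down one row, and the last is released as
    \<open>w\<close>. Their factors cancel against the part of \<open>cross\<close> between the
    first entry and the other entries.\<close>
  have "(\<Sum>x\<in>V. c x * symsum t (Suc ?k) (V - {x}) (\<lambda>ys. x ^ a * tail_word t x l ys)) =
     symsum t (Suc ?k) V (\<lambda>zs. \<Sum>w\<in>V - set zs. cross t w (V - set zs - {w}) *
      (c (hd zs) * (hd zs ^ a * tail_word t (hd zs) l (tl zs @ [w]))) / cross t (hd zs) (V - {hd zs}))"
    unfolding symsum_cmult[symmetric] by (rule sum_symsum_rotate[OF V res])
  also have "\<dots> = symsum t (Suc ?k) V (\<lambda>zs. monom_eval (a # l) zs *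
      (c (hd zs) / cross t (hd zs) (V - set zs) *
        (\<Sum>w\<in>V - set zs. (1 - t) * w / (hd zs - w) * cross t w (V - set zs - {w}))))"
  proof (rule symsum_cong)
    fix zs :: "'a list" assume "length zs = Suc ?k" "distinct zs" "set zs \<subseteq> V"
    then obtain z ys where zs: "zs = z # ys" "length l = length ys" "distinct ys" "z \<notin> set ys"
      "z \<in> V" "set ys \<subseteq> V - {z}" by (cases zs) auto
    have cz: "cross t z (V - {z}) = cross t z (set ys) * cross t z (V - set zs)"
    proof -
      have "V - set zs = V - {z} - set ys" unfolding zs(1) by auto
      then show ?thesis using cross_split[OF finite_Diff[OF V] zs(6)] by simp
    qed
    have nz: "cross t z (set ys) \<noteq> 0"
      using zs res by (intro cross_nonzero) auto
    have "cross t w (V - set zs - {w}) * (c z * (z ^ a * tail_word t z l (ys @ [w]))) / cross t z (V - {z}) =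
        monom_eval (a # l) zs * (c z / cross t z (V - set zs) *
          ((1 - t) * w / (z - w) * cross t w (V - set zs - {w})))" for w
    proof -
      have "C * (d * (p * (m * K * u))) / (K * D) = p * m * (d / D * (u * C))" if "K \<noteq> 0"
        for C d p m K u D :: 'a using that by simp
      from this[OF nz] show ?thesis
        by (simp only: tail_word_append[OF zs(2,3)] cz zs(1) monom_eval.simps list.sel)
    qed
    then show "(\<Sum>w\<in>V - set zs. cross t w (V - set zs - {w}) *
      (c (hd zs) * (hd zs ^ a * tail_word t (hd zs) l (tl zs @ [w]))) / cross t (hd zs) (V - {hd zs})) =
      monom_eval (a # l) zs * (c (hd zs) / cross t (hd zs) (V - set zs) *
        (\<Sum>w\<in>V - set zs. (1 - t) * w / (hd zs - w) * cross t w (V - set zs - {w})))"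
      unfolding sum_distrib_left by (simp only: zs(1) list.sel)
  qed
  finally have B: "(\<Sum>x\<in>V. c x * symsum t (Suc ?k) (V - {x}) (\<lambda>ys. x ^ a * tail_word t x l ys)) = \<dots>" .

  have "(\<Sum>x\<in>V. c x * symsum t (Suc ?k) (V - {x}) (word_sum t x (a # l))) =
    symsum t (Suc ?k) V (\<lambda>zs. monom_eval (a # l) zs * ((\<Sum>w\<in>V - set zs. c w) +
      (\<Sum>y\<in>set (tl zs). c y / cross t y (V - set zs) *
        (\<Sum>w\<in>V - set zs. (1 - t) * w / (y - w) * cross t w (V - set zs - {w})))) +
      monom_eval (a # l) zs * (c (hd zs) / cross t (hd zs) (V - set zs) *
        (\<Sum>w\<in>V - set zs. (1 - t) * w / (hd zs - w) * cross t w (V - set zs - {w}))))"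
    unfolding symsum_add A[symmetric] B[symmetric] word_sum.simps
    by (simp only: distrib_left sum.distrib)
  also have "\<dots> = symsum t (Suc ?k) V (\<lambda>zs. monom_eval (a # l) zs * ((\<Sum>w\<in>V - set zs. c w) + ?R V zs))"
  proof (rule symsum_cong)
    fix zs :: "'a list" assume "length zs = Suc ?k" "distinct zs"
    then obtain z ys where zs: "zs = z # ys" "z \<notin> set ys" by (cases zs) auto
    define h where "h y = c y / cross t y (V - set zs) *
        (\<Sum>w\<in>V - set zs. (1 - t) * w / (y - w) * cross t w (V - set zs - {w}))" for y
    have "(\<Sum>y\<in>set zs. h y) = h (hd zs) + (\<Sum>y\<in>set (tl zs). h y)" using zs by simp
    then show "monom_eval (a # l) zs * ((\<Sum>w\<in>V - set zs. c w) +
      (\<Sum>y\<in>set (tl zs). c y / cross t y (V - set zs) *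
        (\<Sum>w\<in>V - set zs. (1 - t) * w / (y - w) * cross t w (V - set zs - {w})))) +
      monom_eval (a # l) zs * (c (hd zs) / cross t (hd zs) (V - set zs) *
        (\<Sum>w\<in>V - set zs. (1 - t) * w / (hd zs - w) * cross t w (V - set zs - {w}))) =
      monom_eval (a # l) zs * ((\<Sum>w\<in>V - set zs. c w) + ?R V zs)"
      unfolding h_def[symmetric] by (simp add: algebra_simps)
  qed
  finally show ?case by simp
qed simp

text \<open>Both sums are brought to the pool \<open>V\<close> with the same monomial. For each list
  \<open>ys\<close> the coefficient of that monomial vanishes by
  \<open>residue_cancellation\<close>, with \<open>set ys\<close> as \<open>Y\<close> and its
  complement as \<open>W\<close>.\<close>

lemma sum_strip_sum_eq_0:
  fixes t :: "'a::field"
  assumes V: "finite V" "0 \<notin> V" and res: "\<And>u v. u \<in> V \<Longrightarrow> v \<in> V \<Longrightarrow> u \<noteq> t * v"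
    and t: "t \<noteq> 0" and two: "(2::'a) \<noteq> 0"
    and lam: "sorted_wrt (\<ge>) lam" "0 \<notin> set lam" and len: "length lam < card V"
  shows "(\<Sum>x\<in>V. x ^ (card V - 1) / (\<Prod>u\<in>V-{x}. x - u) *
    (symsum t (length lam) (V - {x}) (strip_sum t x 0 True lam) -
     t ^ length lam * symsum t (length lam) (V - {x}) (monom_eval lam))) = 0"
proof -
  define c where "c v = v ^ (card V - 1) / (\<Prod>u\<in>V-{v}. v - u)" for v
  let ?k = "length lam"
  let ?G = "\<lambda>w ys. t ^ ?k * c w / (\<Prod>y\<in>set ys. (y - t * w) / (y - w))"
  let ?R = "\<lambda>ys. \<Sum>y\<in>set ys. c y / cross t y (V - set ys) *
        (\<Sum>w\<in>V - set ys. (1 - t) * w / (y - w) * cross t w (V - set ys - {w}))"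
  have "(\<Sum>x\<in>V. c x * (symsum t ?k (V - {x}) (strip_sum t x 0 True lam) -
      t ^ ?k * symsum t ?k (V - {x}) (monom_eval lam))) =
    (\<Sum>x\<in>V. c x * symsum t ?k (V - {x}) (word_sum t x lam)) -
    (\<Sum>x\<in>V. symsum t ?k (V - {x}) (\<lambda>ys. t ^ ?k * c x * monom_eval lam ys))"
    using V by (simp add: symsum_strip_sum_eq_word_sum two lam symsum_cmult right_diff_distrib
      sum_subtractf) (simp only: mult_ac)
  also have "\<dots> = symsum t ?k V (\<lambda>ys. monom_eval lam ys * ((\<Sum>w\<in>V - set ys. c w) + ?R ys)) -
    symsum t ?k V (\<lambda>ys. \<Sum>w\<in>V - set ys. t ^ ?k * c w * monom_eval lam ys / (\<Prod>y\<in>set ys. (y - t * w) / (y - w)))"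
    by (rule arg_cong2[where f = "(-)"], rule sum_symsum_word_sum[OF V(1)], rule res, assumption+,
        rule sum_symsum_remove[OF V(1)], rule res)
  also have "\<dots> = symsum t ?k V (\<lambda>ys. monom_eval lam ys * ((\<Sum>w\<in>V - set ys. c w - ?G w ys) + ?R ys))"
    unfolding symsum_diff[symmetric]
  proof (rule symsum_cong)
    fix ys :: "'a list"
    have "(\<Sum>w\<in>V - set ys. t ^ ?k * c w * monom_eval lam ys / (\<Prod>y\<in>set ys. (y - t * w) / (y - w))) =
        monom_eval lam ys * (\<Sum>w\<in>V - set ys. ?G w ys)"
      unfolding sum_distrib_left by (intro sum.cong refl) (simp only: times_divide_eq_right mult_ac)
    then show "monom_eval lam ys * ((\<Sum>w\<in>V - set ys. c w) + ?R ys) -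
        (\<Sum>w\<in>V - set ys. t ^ ?k * c w * monom_eval lam ys / (\<Prod>y\<in>set ys. (y - t * w) / (y - w))) =
        monom_eval lam ys * ((\<Sum>w\<in>V - set ys. c w - ?G w ys) + ?R ys)"
      by (simp only: sum_subtractf algebra_simps)
  qed
  also have "\<dots> = symsum t ?k V (\<lambda>ys. 0)"
  proof (rule symsum_cong)
    fix ys assume ys: "length ys = ?k" "distinct ys" "set ys \<subseteq> V"
    have card: "card (set ys) = ?k" using ys by (simp add: distinct_card)
    have un: "set ys \<union> (V - set ys) = V" using ys by auto
    \<comment> \<open>The strict bound \<open>len\<close> provides the variable outside
      \<open>ys\<close> that \<open>residue_cancellation\<close> requires.\<close>
    have ne: "V - set ys \<noteq> {}"
      using card len ys by (metis Diff_eq_empty_iff card_mono finite_set leD)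
    have "(\<Sum>w\<in>V - set ys. c w - t ^ card (set ys) * c w / (\<Prod>y\<in>set ys. (y - t * w) / (y - w))) + ?R ys = 0"
      by (rule residue_cancellation) (use V ne t res ys un in \<open>auto simp: c_def\<close>)
    then show "monom_eval lam ys * ((\<Sum>w\<in>V - set ys. c w - ?G w ys) + ?R ys) = 0"
      unfolding card by simp
  qed
  finally show ?thesis by (simp add: symsum_zero c_def)
qed

section \<open>Translation of the statement\<close>

lemma interlaces_Cons:
  "interlaces (a # l) (m # \<mu>) \<longleftrightarrow> m \<le> a \<and> part l 0 \<le> m \<and> interlaces l \<mu>"
proof -
  have all: "(\<forall>j. P j) \<longleftrightarrow> P 0 \<and> (\<forall>j. P (Suc j))" for P :: "nat \<Rightarrow> bool"
    by (metis not0_implies_Suc)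
  show ?thesis
    unfolding interlaces_def by (subst all) (simp only: part_Cons conj_assoc)
qed

text \<open>Interlacing alone would let the last row of \<open>\<mu>\<close> shrink to 0; the lower
  bound 1 in \<open>strip_inner\<close> expresses that it keeps its part.\<close>

lemma interlaces_iff_strip_inner:
  assumes "length \<mu> = length lam" "0 \<notin> set lam"
  shows "interlaces lam \<mu> \<and> 0 \<notin> set \<mu> \<longleftrightarrow> \<mu> \<in> strip_inner lam"
  using assms
proof (induction lam arbitrary: \<mu>)
  case Nil
  then show ?case by (simp add: interlaces_def part_def)
next
  case (Cons a l)
  then obtain m \<nu> where \<mu>: "\<mu> = m # \<nu>" by (cases \<mu>) auto
  have IH: "interlaces l \<nu> \<and> 0 \<notin> set \<nu> \<longleftrightarrow> \<nu> \<in> strip_inner l"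
    using Cons \<mu> by simp
  have hd: "part l 0 = (if l = [] then 0 else hd l)" by (cases l) (simp_all add: part_def)
  have "l \<noteq> [] \<Longrightarrow> 0 < hd l" using Cons.prems(2) by (cases l) auto
  then have "part l 0 \<le> m \<and> m \<noteq> 0 \<longleftrightarrow> (if l = [] then 1 else hd l) \<le> m" unfolding hd by auto
  then show ?case using IH unfolding \<mu> interlaces_Cons by auto
qed

lemma is_partition_strip_inner:
  assumes "is_partition lam" "\<mu> \<in> strip_inner lam"
  shows "is_partition \<mu>"
proof -
  have "sorted_wrt (\<ge>) \<mu>" if "sorted_wrt (\<ge>) lam" using that assms(2)
  proof (induction lam arbitrary: \<mu>)
    case (Cons a l)
    from Cons.prems(2) obtain m \<nu> where \<mu>: "\<mu> = m # \<nu>" "\<nu> \<in> strip_inner l" "l \<noteq> [] \<Longrightarrow> hd l \<le> m"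
      by (auto split: if_splits)
    have sl: "sorted_wrt (\<ge>) l" using Cons.prems(1) by simp
    have "p \<le> m" if p: "p \<in> set \<nu>" for p
    proof -
      have "l \<noteq> []" using p \<mu>(2) by auto
      then show ?thesis using strip_inner_le_hd[OF sl \<mu>(2) p] \<mu>(3) by simp
    qed
    then show ?case using Cons.IH[OF sl \<mu>(2)] \<mu>(1) by simp
  qed simp
  moreover have "0 \<notin> set \<mu>"
    using interlaces_iff_strip_inner[of \<mu> lam] assms length_strip_inner[OF assms(2)]
    by (simp add: is_partition_def)
  ultimately show ?thesis using assms(1) by (simp add: is_partition_def)
qed

lemma self_in_strip_inner:
  "is_partition lam \<Longrightarrow> lam \<in> strip_inner lam"
proof (induction lam)
  case (Cons a l)
  then have "is_partition l" "(if l = [] then 1 else hd l) \<le> a" by (auto simp: is_partition_def)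
  then show ?case using Cons by auto
qed simp

lemma hl_phi_eq_gen_phi:
  assumes "is_partition lam" "\<mu> \<in> strip_inner lam"
  shows "hl_phi t lam \<mu> = gen_phi t 0 True lam \<mu>"
  using interlaces_iff_strip_inner[of \<mu> lam] length_strip_inner[OF assms(2)] assms
  by (simp add: hl_phi_def gen_phi_def strip_ends_def is_partition_def)

lemma gen_phi_self: "gen_phi t k True lam lam = 1"
  by (simp add: gen_phi_def strip_ends_def)

lemma sum_parts_eq_sum_list:
  assumes "length \<mu> = length lam"
  shows "(\<Sum>j<length lam. part lam j - part \<mu> j) = sum_list (map2 (-) lam \<mu>)"
  using assms by (simp add: sum_list_sum_nth atLeast0LessThan part_def)

lemma sum_list_map2_self: "sum_list (map2 (-) l l) = (0 :: nat)"
  by (induction l) auto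

lemma vandermonde_eq_pair_prod: "vandermonde xs = pair_prod (-) xs"
  by (simp add: vandermonde_def pair_prod_def)

text \<open>Moving \<open>x\<close> to the front reverses one difference for each entry of
  \<open>us\<close>.\<close>

lemma vandermonde_remove:
  "vandermonde (us @ x # vs) =
    (-1) ^ length us * prod_list (map ((-) x) (us @ vs)) * vandermonde (us @ vs)"
  unfolding vandermonde_eq_pair_prod
proof (induction us)
  case (Cons u us)
  have sgn: "prod_list (map ((-) u) (us @ x # vs)) = - (x - u) * prod_list (map ((-) u) (us @ vs))"
    by simp
  then show ?case
    unfolding append_Cons pair_prod_Cons Cons.IH sgn
    by (simp only: length_Cons power_Suc list.map prod_list.Cons mult_minus_left mult_minus_right
        mult_1_left mult_ac)
qed (simp add: pair_prod_Cons)

section \<open>The indeterminates in the fraction field\<close>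

lemma Fract_1_eq_iff: "Fract a 1 = Fract b 1 \<longleftrightarrow> a = b"
  by (simp add: eq_fract)

lemma T_power: "T ^ j = Fract (Poly_Mapping.single 0 ([:0, 1:] ^ j)) 1"
  by (induction j) (simp_all add: T_def One_fract_def Poly_Mapping.mult_single del: One_nat_def)

lemma T_power_neq_1:
  assumes "0 < j"
  shows "T ^ j \<noteq> 1"
proof
  assume "T ^ j = 1"
  then have "Poly_Mapping.single (0 :: nat \<Rightarrow>\<^sub>0 nat) ([:0, 1:] ^ j :: int poly) = 1"
    unfolding T_power One_fract_def Fract_1_eq_iff .
  from arg_cong[OF this, of "\<lambda>p. Poly_Mapping.lookup p 0"]
  have "[:0, 1:] ^ j = (1 :: int poly)" by simp
  then have "poly ([:0, 1:] ^ j) 0 = (1 :: int)" by simp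
  then show False using assms by (cases j) (simp_all add: poly_power)
qed

text \<open>At the exponent \<open>Poly_Mapping.single i 1\<close> the left side has coefficient 1,
  the right side \<open>c\<close> or 0. The cases \<open>c = [:0, 1:]\<close> and
  \<open>c = 0\<close> are used below.\<close>

lemma single_monom_neq:
  assumes "c \<noteq> 1"
  shows "Poly_Mapping.single (Poly_Mapping.single i 1) (1 :: int poly) \<noteq>
    Poly_Mapping.single (m :: nat \<Rightarrow>\<^sub>0 nat) c"
proof
  assume "Poly_Mapping.single (Poly_Mapping.single i 1) (1 :: int poly) = Poly_Mapping.single m c"
  from arg_cong[OF this, of "\<lambda>p. Poly_Mapping.lookup p (Poly_Mapping.single i 1)"]
  show False using assms by (simp add: Poly_Mapping.lookup_single when_def split: if_splits)
qed

lemma X_neq_T_mult_X: "X i \<noteq> T * X j"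
proof -
  have "T * X j = Fract (Poly_Mapping.single (Poly_Mapping.single j 1) [:0, 1:]) 1"
    by (simp add: T_def X_def Poly_Mapping.mult_single)
  moreover have "[:0, 1:] \<noteq> (1 :: int poly)" by (simp add: one_pCons)
  ultimately show ?thesis unfolding X_def Fract_1_eq_iff by (simp add: single_monom_neq Fract_1_eq_iff del: One_nat_def)
qed

lemma X_neq_0: "X i \<noteq> 0"
proof -
  have "X i \<noteq> Fract (Poly_Mapping.single 0 0) 1"
    unfolding X_def Fract_1_eq_iff by (rule single_monom_neq) simp
  then show ?thesis by (simp add: Zero_fract_def)
qed

lemma T_neq_0: "T \<noteq> 0"
proof
  assume "T = 0"
  then have "Fract (Poly_Mapping.single (0 :: nat \<Rightarrow>\<^sub>0 nat) [:0, 1 :: int:]) 1 = Fract 0 1"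
    unfolding T_def Zero_fract_def .
  then have "Poly_Mapping.single (0 :: nat \<Rightarrow>\<^sub>0 nat) [:0, 1 :: int:] = 0"
    unfolding Fract_1_eq_iff .
  from arg_cong[OF this, of "\<lambda>p. Poly_Mapping.lookup p 0"] show False by simp
qed

lemma inj_X: "inj X"
proof (rule injI)
  fix i j assume "X i = X j"
  then have "Poly_Mapping.single (Poly_Mapping.single i 1) (1 :: int poly) =
      Poly_Mapping.single (Poly_Mapping.single j (1::nat)) 1"
    unfolding X_def Fract_1_eq_iff .
  from arg_cong[OF this, of "\<lambda>p. Poly_Mapping.lookup p (Poly_Mapping.single i 1)"]
  have "Poly_Mapping.single j (1::nat) = Poly_Mapping.single i 1"
    by (simp add: Poly_Mapping.lookup_single when_def split: if_splits)
  from arg_cong[OF this, of "\<lambda>p. Poly_Mapping.lookup p i"] show "i = j"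
    by (simp add: Poly_Mapping.lookup_single when_def split: if_splits)
qed

lemma two_neq_0: "(2 :: zt_mpoly fract) \<noteq> 0"
proof -
  have "(2 :: zt_mpoly fract) = Fract 1 1 + Fract 1 1" by (simp add: One_fract_def[symmetric])
  also have "\<dots> = Fract 2 1" by simp
  also have "\<dots> \<noteq> Fract 0 1" unfolding Fract_1_eq_iff by simp
  finally show ?thesis unfolding Zero_fract_def .
qed

section \<open>The variables with one omitted\<close>

lemma vars_omit_append:
  assumes "i \<in> {1..N}"
  shows "vars_omit N i = map X [1..<i] @ map X [Suc i..<Suc N]"
proof -
  have "[1..<Suc N] = [1..<i] @ i # [Suc i..<Suc N]"
    using assms upt_add_eq_append[of 1 i "Suc N - i"] by (simp add: upt_conv_Cons del: upt_Suc)
  then have "remove1 i [1..<Suc N] = [1..<i] @ [Suc i..<Suc N]"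
    by (simp add: remove1_append)
  then show ?thesis by (simp add: vars_omit_def)
qed

lemma set_vars_omit:
  assumes "i \<in> {1..N}"
  shows "set (vars_omit N i) = X ` {1..N} - {X i}"
proof -
  have "{1..<i} \<union> {Suc i..<Suc N} = {1..N} - {i}" using assms by auto
  then have "set (vars_omit N i) = X ` ({1..N} - {i})"
    unfolding vars_omit_append[OF assms] by (simp only: set_append set_map set_upt image_Un[symmetric])
  then show ?thesis by (simp add: image_set_diff[OF inj_X])
qed

lemma distinct_vars_omit: "distinct (vars_omit N i)"
  by (simp add: vars_omit_def distinct_map inj_on_subset[OF inj_X])

text \<open>\<open>X i\<close> is preceded by \<open>i - 1\<close> variables, which accounts for the
  sign. The full Vandermonde product thus factors out of the theorem, and together with
  \<open>X i ^ (N - 1)\<close> the weights of \<open>sum_power_residues\<close> remain.\<close>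

lemma vandermonde_vars_omit:
  assumes "i \<in> {1..N}"
  shows "(-1) ^ (i + 1) * vandermonde (vars_omit N i) =
    vandermonde (map X [1..<Suc N]) / (\<Prod>u\<in>X ` {1..N} - {X i}. X i - u)"
proof -
  let ?V = "X ` {1..N} - {X i}"
  have eq: "[1..<Suc N] = [1..<i] @ i # [Suc i..<Suc N]"
    using assms upt_add_eq_append[of 1 i "Suc N - i"] by (simp add: upt_conv_Cons del: upt_Suc)
  have prod: "prod_list (map ((-) (X i)) (vars_omit N i)) = (\<Prod>u\<in>?V. X i - u)"
    unfolding set_vars_omit[OF assms, symmetric]
    by (rule prod.distinct_set_conv_list[OF distinct_vars_omit, symmetric])
  have nz: "(\<Prod>u\<in>?V. X i - u) \<noteq> 0" by auto
  have "vandermonde (map X [1..<Suc N]) =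
      (-1) ^ (i - 1) * (\<Prod>u\<in>?V. X i - u) * vandermonde (vars_omit N i)"
    using vandermonde_remove[of "map X [1..<i]" "X i" "map X [Suc i..<Suc N]"]
    unfolding vars_omit_append[OF assms, symmetric] prod unfolding eq by simp
  moreover have "(-1) ^ (i + 1) = ((-1) ^ (i - 1) :: zt_mpoly fract)"
    using assms by (cases i) auto
  ultimately show ?thesis using nz
    by (simp add: mult_ac)
qed

text \<open>The term \<open>F lam\<close> is the case \<open>\<mu> = lam\<close>, with coefficient 1
  and exponent 0. Strips with vanishing coefficient may be added freely.\<close>

lemma sum_inner_partitions:
  assumes lam: "is_partition lam"
  shows "F lam + (\<Sum>\<mu>\<in>inner_partitions lam. x ^ (\<Sum>j<length lam. part lam j - part \<mu> j) * F \<mu> * hl_phi T lam \<mu>) =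
    (\<Sum>\<mu>\<in>strip_inner lam. gen_phi T 0 True lam \<mu> * x ^ sum_list (map2 (-) lam \<mu>) * F \<mu>)"
proof -
  have "(\<Sum>\<mu>\<in>inner_partitions lam. x ^ (\<Sum>j<length lam. part lam j - part \<mu> j) * F \<mu> * hl_phi T lam \<mu>) =
    (\<Sum>\<mu>\<in>strip_inner lam - {lam}. gen_phi T 0 True lam \<mu> * x ^ sum_list (map2 (-) lam \<mu>) * F \<mu>)"
  proof (rule sum.mono_neutral_cong_left)
    show "inner_partitions lam \<subseteq> strip_inner lam - {lam}"
      using interlaces_iff_strip_inner[of _ lam] lam
      by (auto simp: inner_partitions_def hl_phi_def is_partition_def split: if_splits)
    show "\<forall>\<mu>\<in>strip_inner lam - {lam} - inner_partitions lam.
        gen_phi T 0 True lam \<mu> * x ^ sum_list (map2 (-) lam \<mu>) * F \<mu> = 0"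
      using hl_phi_eq_gen_phi[OF lam, of _ T] is_partition_strip_inner[OF lam] length_strip_inner
      by (auto simp: inner_partitions_def)
    fix \<mu> assume "\<mu> \<in> inner_partitions lam"
    then have "\<mu> \<in> strip_inner lam" "length \<mu> = length lam"
      using \<open>inner_partitions lam \<subseteq> strip_inner lam - {lam}\<close> length_strip_inner by auto
    then show "x ^ (\<Sum>j<length lam. part lam j - part \<mu> j) * F \<mu> * hl_phi T lam \<mu> =
      gen_phi T 0 True lam \<mu> * x ^ sum_list (map2 (-) lam \<mu>) * F \<mu>"
      by (simp only: hl_phi_eq_gen_phi[OF lam] sum_parts_eq_sum_list mult_ac)
  qed (simp add: finite_strip_inner)
  then show ?thesis
    by (simp add: sum.remove[OF finite_strip_inner self_in_strip_inner[OF lam]] gen_phi_self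
      sum_list_map2_self)
qed

theorem mainTheorem3:
  fixes N :: nat and lam :: "nat list"
  assumes "N \<ge> 1" and "is_partition lam" and "0 < length lam" and "length lam < N"
  shows "(\<Sum>i=1..N. (-1) ^ (i + 1) * X i ^ (N - 1) * vandermonde (vars_omit N i) *
            (hl_Q T lam (vars_omit N i) * (1 - T ^ length lam) +
             (\<Sum>\<mu>\<in>inner_partitions lam.
                X i ^ (\<Sum>j<length lam. part lam j - part \<mu> j) *
                hl_Q T \<mu> (vars_omit N i) * hl_phi T lam \<mu>))) = 0"
proof -
  let ?k = "length lam" and ?V = "X ` {1..N}"
  let ?S = "\<lambda>x. symsum T ?k (?V - {x})"
  \<comment> \<open>The factor common to all summands, from \<open>hl_Q_eq_symsum\<close> and
    \<open>vandermonde_vars_omit\<close>.\<close>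
  let ?c = "(1 - T) ^ ?k * vandermonde (map X [1..<Suc N])"
  have card: "card ?V = N" by (simp add: card_image inj_on_subset[OF inj_X])
  have summand: "(-1) ^ (i + 1) * X i ^ (N - 1) * vandermonde (vars_omit N i) *
            (hl_Q T lam (vars_omit N i) * (1 - T ^ ?k) +
             (\<Sum>\<mu>\<in>inner_partitions lam. X i ^ (\<Sum>j<?k. part lam j - part \<mu> j) *
                hl_Q T \<mu> (vars_omit N i) * hl_phi T lam \<mu>)) =
      ?c * (X i ^ (card ?V - 1) / (\<Prod>u\<in>?V - {X i}. X i - u) *
        (?S (X i) (strip_sum T (X i) 0 True lam) - T ^ ?k * ?S (X i) (monom_eval lam)))"
    (is "?l = ?r") if i: "i \<in> {1..N}" for i
  proof -
    let ?Q = "\<lambda>\<mu>. hl_Q T \<mu> (vars_omit N i)"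
    have len: "length (vars_omit N i) = N - 1"
      using i unfolding vars_omit_append[OF i] by auto
    have Q: "?Q \<mu> = (1 - T) ^ ?k * ?S (X i) (monom_eval \<mu>)" if "length \<mu> = ?k" for \<mu>
      unfolding that[symmetric] set_vars_omit[OF i, symmetric]
      using that assms len X_neq_0
      by (intro hl_Q_eq_symsum distinct_vars_omit T_power_neq_1) (auto simp: set_vars_omit[OF i])
    \<comment> \<open>The 1 in \<open>1 - T ^ ?k\<close> supplies the missing term
      \<open>\<mu> = lam\<close> of the sum over strips.\<close>
    have "?Q lam * (1 - T ^ ?k) + (\<Sum>\<mu>\<in>inner_partitions lam. X i ^ (\<Sum>j<?k. part lam j - part \<mu> j) *
          ?Q \<mu> * hl_phi T lam \<mu>) =
        (\<Sum>\<mu>\<in>strip_inner lam. gen_phi T 0 True lam \<mu> * X i ^ sum_list (map2 (-) lam \<mu>) * ?Q \<mu>) -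
        T ^ ?k * ?Q lam"
      unfolding sum_inner_partitions[OF assms(2), of ?Q "X i", symmetric] by (simp add: algebra_simps)
    also have "(\<Sum>\<mu>\<in>strip_inner lam. gen_phi T 0 True lam \<mu> * X i ^ sum_list (map2 (-) lam \<mu>) * ?Q \<mu>) =
        (1 - T) ^ ?k * ?S (X i) (strip_sum T (X i) 0 True lam)"
      unfolding strip_sum_def symsum_sum symsum_cmult sum_distrib_left
      by (intro sum.cong refl) (simp only: Q length_strip_inner mult_ac)
    finally have inner: "?Q lam * (1 - T ^ ?k) + (\<Sum>\<mu>\<in>inner_partitions lam. X i ^ (\<Sum>j<?k. part lam j - part \<mu> j) *
          ?Q \<mu> * hl_phi T lam \<mu>) =
        (1 - T) ^ ?k * (?S (X i) (strip_sum T (X i) 0 True lam) - T ^ ?k * ?S (X i) (monom_eval lam))"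
      unfolding Q[OF refl] by (simp only: right_diff_distrib mult.left_commute)
    have "?l = ((-1) ^ (i + 1) * vandermonde (vars_omit N i)) * X i ^ (N - 1) * ((1 - T) ^ ?k *
        (?S (X i) (strip_sum T (X i) 0 True lam) - T ^ ?k * ?S (X i) (monom_eval lam)))"
      unfolding inner by (simp only: mult_ac)
    also have "\<dots> = ?r"
      unfolding vandermonde_vars_omit[OF i] card
      by (simp only: times_divide_eq_left times_divide_eq_right mult_ac)
    finally show ?thesis .
  qed
  have len_card: "length lam < card ?V" unfolding card by fact
  have "(\<Sum>x\<in>?V. x ^ (card ?V - 1) / (\<Prod>u\<in>?V - {x}. x - u) *
      (?S x (strip_sum T x 0 True lam) - T ^ ?k * ?S x (monom_eval lam))) = 0"
    using assms(2) X_neq_T_mult_X X_neq_0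
    by (intro sum_strip_sum_eq_0 two_neq_0 T_neq_0 len_card) (auto simp: is_partition_def)
  then have zero: "(\<Sum>i=1..N. X i ^ (card ?V - 1) / (\<Prod>u\<in>?V - {X i}. X i - u) *
      (?S (X i) (strip_sum T (X i) 0 True lam) - T ^ ?k * ?S (X i) (monom_eval lam))) = 0"
    by (simp add: sum.reindex inj_on_subset[OF inj_X])
  show ?thesis
    by (rule trans[OF sum.cong[OF refl summand]], assumption)
      (simp only: sum_distrib_left[symmetric] zero mult_zero_right)
qed

end
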